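(* Let $f_0$ be a probability density on $[0,1]$ with $\|\log f_0\|_\infty<\infty$, let $X_1,\dots,X_n$ be i.i.d. with density $f_0$ (law $\mathbb P_0$), and let $\Psi(f)=\int_0^1 f(x)\psi(x)\,dx$ with $\|\psi\|_\infty<\infty$. Let $\pi$ be a prior on $\mathcal F$ such that the following three assumptions hold. (A1) There exists $u_n=o(1)$ such that, with $A^1_{u_n}=\{f\in\mathcal F:\ V(f_0,f)\le u_n^2\}$, one has $\mathbb P^\pi\{A^1_{u_n}\mid X^n\}=1+o_{\mathbb P_0}(1)$. (A2) The subsets $A_n\subset A^1_{u_n}$ of densities $f$ such that $\int_0^1\left|\log\left(\frac{f(x)}{f_0(x)}\right)\right|^3\,(f_0(x)+f(x))\,dx=o(1)$ (uniformly over $f\in A_n$) satisfy $\mathbb P^\pi\{A_n\mid X^n\}=1+o_{\mathbb P_0}(1)$. (A3) For every $t\in\mathbb R$, $$\frac{\int_{A_n}\exp\left(-\frac{F_0((h_f-t\bar\psi_{t,n})^2)}{2}+G_n(h_f-t\bar\psi_{t,n})+R_n(h_f-t\bar\psi_{t,n})\right)d\pi(f)}{\int_{A_n}\exp\left(-\frac{F_0(h_f^2)}{2}+G_n(h_f)+R_n(h_f)\right)d\pi(f)}=1+o_{\mathbb P_0}(1).$$ Then, with $\Psi(P_n)=P_n(\psi)=\frac1n\sum_{i=1}^n\psi(X_i)$, for every $z\in\mathbb R$, $$\mathbb P^\pi\left\{\sqrt n\,(\Psi(f)-\Psi(P_n))\le z\mid X^n\right\}-\Phi_{F_0(\psi_c^2)}(z)\to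 0$$ in probability with respect to $\mathbb P_0$, as $n\to\infty$.
   Context: $\mathcal F=\{f:[0,1]\to\mathbb R^+:\ \int_0^1 f(x)\,dx=1\}$. $X^n=(X_1,\dots,X_n)$, and $\mathbb P^\pi[\cdot\mid X^n]$ is the posterior distribution of $f$ given $X^n$ under the prior $\pi$ (for the i.i.d. likelihood $\prod_i f(X_i)$). For a function $g$: $F_0(g)=\int_0^1 f_0(x)g(x)\,dx$, $P_n(g)=\frac1n\sum_{i=1}^n g(X_i)$, $G_n(g)=\frac1{\sqrt n}\sum_{i=1}^n[g(X_i)-F_0(g)]$. $V(f_0,f)=F_0\left((\log(f_0/f))^2\right)$. $\Phi_V$ is the cumulative distribution function of the centered Gaussian law with variance $V$. $o_{\mathbb P_0}(1)$ denotes convergence to $0$ in $\mathbb P_0$-probability as $n\to\infty$. $\Psi$ is a continuous linear form on $\mathbb L_2[0,1]$ represented by $\psi$, and $\psi_c(x)=\psi(x)-F_0(\psi)$. For a density $f$, $h=h_f$ is defined by $h_f(x)=\sqrt n\log\left(\frac{f(x)}{f_0(x)}\right)$, i.e. $f=f_0\exp(h_f/\sqrt n)$. For a function $h$, $R_n(h)=\sqrt n F_0(h)+\frac{F_0(h^2)}{2}$. For $t\neq 0$ and $h=h_f$, $$\bar\psi_{t,n}(x)=\psi_c(x)+\frac{\sqrt n}{t}\log\left(F_0\left[\exp\left(\frac{h}{\sqrt n}-\frac{t\psi_c}{\sqrt n}\right)\right]\right)$$ (so $\bar\psi_{t,n}$ depends on $f$; for $t=0$ the ratio in (A3) is read as $1$).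 *)

theory Defs
  imports "HOL-Probability.Probability"
begin

text \<open>Lebesgue measure on the unit interval. Functions on the unit interval are rendered as
  functions \<^typ>\<open>real \<Rightarrow> real\<close> whose values outside of it are irrelevant.\<close>

definition leb01 :: "real measure" where
  "leb01 = restrict_space lborel {0..1}"

definition densities :: "(real \<Rightarrow> real) set" where
  "densities = {f. (\<forall>x\<in>{0..1}. 0 \<le> f x) \<and> has_bochner_integral leb01 f 1}"

text \<open>The logarithm on the nonnegative reals with value \<open>-\<infinity>\<close> at 0. The library's \<open>ln\<close> has
  \<open>ln 0 = 0\<close>, which would make a density that vanishes on a set of positive measure look close
  to \<open>f\<^sub>0\<close>. In \<open>V\<close> below, \<open>f\<^sub>0 x / 0 = 0\<close> is sent to \<open>-\<infinity>\<close> instead of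
  \<open>+\<infinity>\<close>, and the square removes the difference.\<close>

definition ext_ln :: "real \<Rightarrow> ereal" where
  "ext_ln r = (if 0 < r then ereal (ln r) else -\<infinity>)"

definition ess_norm :: "(real \<Rightarrow> ereal) \<Rightarrow> ereal" where
  "ess_norm g = esssup leb01 (\<lambda>x. \<bar>g x\<bar>)"

definition F0 :: "(real \<Rightarrow> real) \<Rightarrow> (real \<Rightarrow> real) \<Rightarrow> real" where
  "F0 f\<^sub>0 g = (LINT x|leb01. f\<^sub>0 x * g x)"

text \<open>The observations \<open>X\<^sub>1, \<dots>, X\<^sub>n\<close> are \<open>x 0, \<dots>, x (n - 1)\<close>.\<close>

definition Pn :: "nat \<Rightarrow> (nat \<Rightarrow> real) \<Rightarrow> (real \<Rightarrow> real) \<Rightarrow> real" where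
  "Pn n x g = (\<Sum>i<n. g (x i)) / real n"

definition Gn :: "(real \<Rightarrow> real) \<Rightarrow> nat \<Rightarrow> (nat \<Rightarrow> real) \<Rightarrow> (real \<Rightarrow> real) \<Rightarrow> real" where
  "Gn f\<^sub>0 n x g = (\<Sum>i<n. g (x i) - F0 f\<^sub>0 g) / sqrt (real n)"

definition Rn :: "(real \<Rightarrow> real) \<Rightarrow> nat \<Rightarrow> (real \<Rightarrow> real) \<Rightarrow> real" where
  "Rn f\<^sub>0 n h = sqrt (real n) * F0 f\<^sub>0 h + F0 f\<^sub>0 (\<lambda>x. (h x)\<^sup>2) / 2"

definition V :: "(real \<Rightarrow> real) \<Rightarrow> (real \<Rightarrow> real) \<Rightarrow> ennreal" where
  "V f\<^sub>0 f = (\<integral>\<^sup>+x. ennreal (f\<^sub>0 x) * e2ennreal ((ext_ln (f\<^sub>0 x / f x))\<^sup>2) \<partial>leb01)"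

definition A1 :: "(real \<Rightarrow> real) \<Rightarrow> real \<Rightarrow> (real \<Rightarrow> real) set" where
  "A1 f\<^sub>0 u = {f \<in> densities. V f\<^sub>0 f \<le> ennreal (u\<^sup>2)}"

definition third_moment :: "(real \<Rightarrow> real) \<Rightarrow> (real \<Rightarrow> real) \<Rightarrow> ennreal" where
  "third_moment f\<^sub>0 f =
     (\<integral>\<^sup>+x. e2ennreal (\<bar>ext_ln (f x / f\<^sub>0 x)\<bar> ^ 3) * ennreal (f\<^sub>0 x + f x) \<partial>leb01)"

text \<open>The prior lives on a measurable space of densities on which evaluation is jointly
  measurable, so that the likelihood is measurable and Bayes' formula makes sense. The carrier is
  only required to be a subset of \<^term>\<open>densities\<close>: by a theorem of Aumann, no
  sigma-algebra makes evaluation jointly measurable on all measurable functions.\<close>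

definition prior :: "(real \<Rightarrow> real) measure \<Rightarrow> bool" where
  "prior \<pi> \<longleftrightarrow> prob_space \<pi> \<and> space \<pi> \<subseteq> densities \<and>
     (\<lambda>(f, x). f x) \<in> borel_measurable (\<pi> \<Otimes>\<^sub>M leb01)"

definition likelihood :: "nat \<Rightarrow> (nat \<Rightarrow> real) \<Rightarrow> (real \<Rightarrow> real) \<Rightarrow> real" where
  "likelihood n x f = (\<Prod>i<n. f (x i))"

definition posterior ::
    "(real \<Rightarrow> real) measure \<Rightarrow> nat \<Rightarrow> (nat \<Rightarrow> real) \<Rightarrow> (real \<Rightarrow> real) measure" where
  "posterior \<pi> n x = density \<pi> (\<lambda>f. ennreal (likelihood n x f) /
                                     (\<integral>\<^sup>+g. ennreal (likelihood n x g) \<partial>\<pi>))"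

definition Psi :: "(real \<Rightarrow> real) \<Rightarrow> (real \<Rightarrow> real) \<Rightarrow> real" where
  "Psi \<psi> f = (LINT x|leb01. f x * \<psi> x)"

definition psi_c :: "(real \<Rightarrow> real) \<Rightarrow> (real \<Rightarrow> real) \<Rightarrow> real \<Rightarrow> real" where
  "psi_c f\<^sub>0 \<psi> x = \<psi> x - F0 f\<^sub>0 \<psi>"

text \<open>Here the library's \<open>ln\<close> is harmless: a density with \<open>V f\<^sub>0 f < \<infinity>\<close> is positive almost
  everywhere on the set where \<open>f\<^sub>0\<close> is.\<close>

definition h_of :: "(real \<Rightarrow> real) \<Rightarrow> nat \<Rightarrow> (real \<Rightarrow> real) \<Rightarrow> real \<Rightarrow> real" where
  "h_of f\<^sub>0 n f x = sqrt (real n) * ln (f x / f\<^sub>0 x)"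

definition psi_bar ::
    "(real \<Rightarrow> real) \<Rightarrow> (real \<Rightarrow> real) \<Rightarrow> real \<Rightarrow> nat \<Rightarrow> (real \<Rightarrow> real) \<Rightarrow> real \<Rightarrow> real" where
  "psi_bar f\<^sub>0 \<psi> t n h x = psi_c f\<^sub>0 \<psi> x + sqrt (real n) / t *
     ln (F0 f\<^sub>0 (\<lambda>y. exp (h y / sqrt (real n) - t * psi_c f\<^sub>0 \<psi> y / sqrt (real n))))"

definition lan_weight :: "(real \<Rightarrow> real) \<Rightarrow> nat \<Rightarrow> (nat \<Rightarrow> real) \<Rightarrow> (real \<Rightarrow> real) \<Rightarrow> real" where
  "lan_weight f\<^sub>0 n x h =
     exp (- F0 f\<^sub>0 (\<lambda>y. (h y)\<^sup>2) / 2 + Gn f\<^sub>0 n x h + Rn f\<^sub>0 n h)"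

definition shift_ratio ::
    "(real \<Rightarrow> real) \<Rightarrow> (real \<Rightarrow> real) \<Rightarrow> (real \<Rightarrow> real) measure \<Rightarrow> (real \<Rightarrow> real) set \<Rightarrow>
     real \<Rightarrow> nat \<Rightarrow> (nat \<Rightarrow> real) \<Rightarrow> real" where
  "shift_ratio f\<^sub>0 \<psi> \<pi> A t n x = (if t = 0 then 1 else
     (LINT f:A|\<pi>. lan_weight f\<^sub>0 n x
        (\<lambda>y. h_of f\<^sub>0 n f y - t * psi_bar f\<^sub>0 \<psi> t n (h_of f\<^sub>0 n f) y)) /
     (LINT f:A|\<pi>. lan_weight f\<^sub>0 n x (h_of f\<^sub>0 n f)))"

text \<open>Convergence of random variables to a constant in probability. Measurability is part of the
  notion because \<^const>\<open>measure\<close> is 0 on non-measurable sets.\<close>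

definition tends_in_prob :: "'w measure \<Rightarrow> (nat \<Rightarrow> 'w \<Rightarrow> real) \<Rightarrow> real \<Rightarrow> bool" where
  "tends_in_prob M Y c \<longleftrightarrow> (\<forall>n. Y n \<in> borel_measurable M) \<and>
     (\<forall>\<epsilon>>0. (\<lambda>n. \<P>(\<omega> in M. \<epsilon> < \<bar>Y n \<omega> - c\<bar>)) \<longlonglongrightarrow> 0)"

text \<open>The centered Gaussian law with variance \<open>v\<close>, the Dirac mass at 0 for \<open>v = 0\<close>;
  \<^const>\<open>normal_density\<close> takes the standard deviation.\<close>

definition centered_gaussian :: "real \<Rightarrow> real measure" where
  "centered_gaussian v =
     (if v = 0 then return borel 0 else density lborel (normal_density 0 (sqrt v)))"

definition Phi :: "real \<Rightarrow> real \<Rightarrow> real" where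
  "Phi v z = cdf (centered_gaussian v) z"

end

theory Submission
  imports Defs "HOL-Complex_Analysis.Complex_Analysis"
begin

text \<open>Write \<open>Z(f) = \<surd>n (\<Psi>(f) - \<Psi>(P\<^sub>n))\<close>. The weight \<^const>\<open>lan_weight\<close> of \<open>h\<close> is
  exactly \<open>exp (\<Sum>h(X\<^sub>i) / \<surd>n)\<close>, hence a likelihood ratio for \<open>h = h\<^sub>f\<close>. Expanding the logarithm
  of the normalizing constant in \<^const>\<open>psi_bar\<close> to second order, uniformly over \<open>A\<^sub>n\<close> because
  \<open>\<parallel>f - f\<^sub>0\<parallel>\<^sub>1 \<le> 2 u\<^sub>n\<close> there, shows that the ratio in (A3) is
  \<open>exp (- t\<^sup>2 F\<^sub>0(\<psi>\<^sub>c\<^sup>2) / 2 + o(1))\<close> times the Laplace transform at \<open>t\<close> of \<open>Z\<close> under the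
  posterior restricted to \<open>A\<^sub>n\<close>. So this Laplace transform tends in probability to that of the
  Gaussian law, for every real \<open>t\<close>, and this forces convergence of the distribution functions.
  If \<open>F\<^sub>0(\<psi>\<^sub>c\<^sup>2) = 0\<close> the limit is discontinuous at 0, but then \<open>Z\<close> vanishes almost surely.\<close>

section \<open>Moment generating functions and weak convergence\<close>

text \<open>Membership in \<open>A1\<close> gives only an L1 rate that tends to 0, without any
  root-n speed. With s = t / \<surd>n, the mean a of \<open>psi_c\<close> under f enters n times the
  logarithm through \<surd>n t a, which may be unbounded over the set. This term is never estimated:
  together with the sample average it recentres \<open>Psi\<close> at its empirical value. The error
  contains a only through n (s a)^2 = t^2 a^2, for which a tending to 0 uniformly is enough. The
  second obstacle is that (A3) speaks of real t, one at a time, and in probability. Real arguments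
  do not reach characteristic functions, hence the passage through holomorphic functions. The
  exceptional samples depend on t, so no single sample is known to behave well for all t. Therefore
  the analytic argument is first recast as a statement about one measure, finitely many t and one
  tolerance. For a fixed sample the rest consists of deterministic inequalities, and probability
  enters through a union bound over the posterior mass of the set and the ratios at these t.\<close>

lemma norm_integral_exp_le:
  fixes M :: "real measure" and w :: complex and N :: real
  assumes "real_distribution M" and int: "\<And>t. integrable M (\<lambda>x. exp (t * x))"
    and w: "norm w \<le> N"
  shows "norm (LINT x|M. exp (w * complex_of_real x)) \<le>
    (LINT x|M. exp (N * x)) + (LINT x|M. exp (- N * x))"
proof -
  interpret real_distribution M by fact
  have N: "0 \<le> N" using w norm_ge_zero order_trans by blast
  have le: "norm (exp (w * complex_of_real x)) \<le> exp (N * x) + exp (- N * x)" for x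
  proof -
    have "norm (exp (w * complex_of_real x)) = exp (Re w * x)"
      by simp
    also have "\<bar>Re w\<bar> * \<bar>x\<bar> \<le> N * \<bar>x\<bar>"
      using abs_Re_le_cmod[of w] w by (intro mult_right_mono) auto
    hence "exp (Re w * x) \<le> exp (N * \<bar>x\<bar>)"
      using abs_ge_self[of "Re w * x"] by (simp add: abs_mult)
    also have "\<dots> \<le> exp (N * x) + exp (- N * x)"
      by (cases "x \<ge> 0") (auto simp: add_increasing add_increasing2)
    finally show ?thesis .
  qed
  have "norm (LINT x|M. exp (w * complex_of_real x)) \<le> (LINT x|M. exp (N * x) + exp (- N * x))"
  proof (rule Bochner_Integration.integral_norm_bound_integral)
    show bnd: "integrable M (\<lambda>x. exp (N * x) + exp (- N * x))"
      by (intro Bochner_Integration.integrable_add int)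
    show "integrable M (\<lambda>x. exp (w * complex_of_real x))"
      by (rule Bochner_Integration.integrable_bound[OF bnd])
         (measurable, intro always_eventually allI order_trans[OF le], simp)
  qed (rule le)
  also have "\<dots> = (LINT x|M. exp (N * x)) + (LINT x|M. exp (- N * x))"
    by (intro Bochner_Integration.integral_add int)
  finally show ?thesis .
qed

text \<open>The partial sums of the exponential series are at most exp (|w| |x|) in modulus, which
  the real exponential moments make integrable. So the series may be integrated term by term, and
  the transform is an everywhere convergent power series whose coefficients are the moments divided
  by factorials.\<close>

lemma complex_mgf_holomorphic:
  fixes M :: "real measure"
  assumes "real_distribution M" and int: "\<And>t. integrable M (\<lambda>x. exp (t * x))"
  shows "(\<lambda>w. LINT x|M. exp (w * complex_of_real x)) holomorphic_on UNIV"
proof -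
  interpret real_distribution M by fact
  define a where "a n = (LINT x|M. complex_of_real x ^ n / fact n)" for n
  have sums: "(\<lambda>n. a n * (w - 0) ^ n) sums (LINT x|M. exp (w * complex_of_real x))" for w
  proof -
    define s where "s n x = (\<Sum>k<n. w ^ k * (complex_of_real x ^ k / fact k))" for n x
    define N where "N = norm w"
    have bound: "norm (\<Sum>k<n. c ^ k * (complex_of_real x ^ k / fact k)) \<le>
        exp (norm c * x) + exp (- norm c * x)" for n x c
    proof -
      have "norm (\<Sum>k<n. c ^ k * (complex_of_real x ^ k / fact k)) \<le>
          (\<Sum>k<n. (norm c * \<bar>x\<bar>) ^ k / fact k)"
        by (rule sum_norm_le) (simp add: norm_mult norm_power norm_divide power_mult_distrib)
      also have "\<dots> \<le> exp (norm c * \<bar>x\<bar>)"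
        using sum_le_suminf[OF summable_exp[of "norm c * \<bar>x\<bar>"], of "{..<n}"]
        by (simp add: exp_def divide_inverse scaleR_conv_of_real mult.commute)
      also have "\<dots> \<le> exp (norm c * x) + exp (- norm c * x)"
        by (cases "x \<ge> 0") (auto simp: add_increasing add_increasing2)
      finally show ?thesis .
    qed
    have int_power: "integrable M (\<lambda>x. complex_of_real x ^ k / fact k)" for k
    proof (rule Bochner_Integration.integrable_bound)
      show "integrable M (\<lambda>x. 2 * (exp (1 * x) + exp (- 1 * x)))"
        by (intro Bochner_Integration.integrable_add integrable_mult_right int)
      have "norm (complex_of_real x ^ k / fact k) \<le> 2 * (exp (1 * x) + exp (- 1 * x))" for x
      proof -
        \<comment> \<open>A single term is the difference of two consecutive partial sums at c = 1,
          so the bound on partial sums also yields the existence of moments. This is where the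
          factor 2 comes from.\<close>
        have "complex_of_real x ^ k / fact k = (\<Sum>j<Suc k. 1 ^ j * (complex_of_real x ^ j / fact j))
           - (\<Sum>j<k. 1 ^ j * (complex_of_real x ^ j / fact j))"
          by simp
        also have "norm \<dots> \<le> (exp (1 * x) + exp (- 1 * x)) + (exp (1 * x) + exp (- 1 * x))"
          using bound[of 1 x "Suc k"] bound[of 1 x k]
          by (intro order_trans[OF norm_triangle_ineq4] add_mono) (auto simp del: sum.lessThan_Suc)
        finally show ?thesis by simp
      qed
      thus "AE x in M. norm (complex_of_real x ^ k / fact k) \<le> norm (2 * (exp (1 * x) + exp (- 1 * x)))"
        by (intro always_eventually allI) (simp add: order_trans[OF _ abs_ge_self])
    qed simp
    have "(\<lambda>n. LINT x|M. s n x) \<longlonglongrightarrow> (LINT x|M. exp (w * complex_of_real x))"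
    proof (rule integral_dominated_convergence)
      show "integrable M (\<lambda>x. exp (N * x) + exp (- N * x))"
        by (intro Bochner_Integration.integrable_add int)
      have "(\<lambda>n. s n x) \<longlonglongrightarrow> exp (w * complex_of_real x)" for x
        using exp_converges[of "w * complex_of_real x"]
        by (simp add: s_def sums_def scaleR_conv_of_real power_mult_distrib divide_inverse mult_ac)
      thus "AE x in M. (\<lambda>n. s n x) \<longlonglongrightarrow> exp (w * complex_of_real x)" by simp
      show "AE x in M. norm (s n x) \<le> exp (N * x) + exp (- N * x)" for n
        unfolding s_def N_def by (intro always_eventually allI bound)
    qed (auto simp: s_def)
    moreover have "(LINT x|M. s n x) = (\<Sum>k<n. a k * (w - 0) ^ k)" for n
    proof -
      have "(LINT x|M. s n x) = (\<Sum>k<n. LINT x|M. w ^ k * (complex_of_real x ^ k / fact k))"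
        unfolding s_def by (intro Bochner_Integration.integral_sum integrable_mult_right int_power)
      also have "\<dots> = (\<Sum>k<n. a k * (w - 0) ^ k)"
        unfolding a_def diff_0_right by (intro sum.cong refl, subst integral_mult_right_zero) (rule mult.commute)
      finally show ?thesis .
    qed
    ultimately show ?thesis by (simp add: sums_def)
  qed
  have "(\<lambda>w. LINT x|M. exp (w * complex_of_real x)) holomorphic_on ball 0 r" for r
    by (rule power_series_holomorphic[OF sums])
  hence "(\<lambda>w. LINT x|M. exp (w * complex_of_real x)) field_differentiable at z" for z
    by (rule holomorphic_on_imp_differentiable_at[of _ "ball 0 (norm z + 1)"]) auto
  thus ?thesis by (simp add: holomorphic_on_def field_differentiable_at_within)
qed

text \<open>A Vitali argument: the complex moment generating functions form a normal family, and by the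
  identity theorem every limit point of it is \<open>exp (w\<^sup>2 / 2)\<close>. On the imaginary axis
  this is convergence of characteristic functions.\<close>

theorem weak_conv_std_normal_of_mgf:
  fixes \<mu> :: "nat \<Rightarrow> real measure"
  assumes distr: "\<And>k. real_distribution (\<mu> k)"
    and int: "\<And>k t. integrable (\<mu> k) (\<lambda>x. exp (t * x))"
    and lim: "\<And>t. t \<in> \<rat> \<Longrightarrow> (\<lambda>k. LINT x|\<mu> k. exp (t * x)) \<longlonglongrightarrow> exp (t\<^sup>2 / 2)"
  shows "weak_conv_m \<mu> std_normal_distribution"
proof (rule levy_continuity[OF distr real_dist_normal_dist])
  fix s :: real
  define \<phi> where "\<phi> k w = (LINT x|\<mu> k. exp (w * complex_of_real x))" for k w
  have hol: "\<phi> k holomorphic_on UNIV" for k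
    unfolding \<phi>_def[abs_def] by (rule complex_mgf_holomorphic[OF distr int])
  have bounded: "\<exists>B. \<forall>h\<in>range \<phi>. \<forall>z\<in>K. norm (h z) \<le> B" if K: "compact K" for K
  proof -
    obtain b where b: "\<And>z. z \<in> K \<Longrightarrow> norm z \<le> b"
      using compact_imp_bounded[OF K] by (auto simp: bounded_iff)
    \<comment> \<open>On a disc of radius N, \<open>norm_integral_exp_le\<close> controls the
      complex transform by the real one at the two points N and -N. The radius is rounded up to a
      natural number because convergence is assumed at rational arguments only.\<close>
    obtain N where N: "b \<le> real N" using real_arch_simple by blast
    have "\<exists>B. \<forall>k. \<bar>LINT x|\<mu> k. exp (t * x)\<bar> \<le> B" if "t \<in> \<rat>" for t
      using convergent_imp_Bseq[OF convergentI[OF lim[OF that]]] by (auto simp: Bseq_def)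
    note bdd = this
    obtain B1 where B1: "\<And>k. \<bar>LINT x|\<mu> k. exp (real N * x)\<bar> \<le> B1"
      using bdd[of "real N"] by (meson Rats_of_nat)
    obtain B2 where B2: "\<And>k. \<bar>LINT x|\<mu> k. exp (- real N * x)\<bar> \<le> B2"
      using bdd[of "- real N"] by (meson Rats_of_nat Rats_minus_iff)
    have "norm (\<phi> k z) \<le> B1 + B2" if "z \<in> K" for k z
      unfolding \<phi>_def
      using norm_integral_exp_le[OF distr int order_trans[OF b[OF that] N], of k] B1[of k] B2[of k]
      by linarith
    thus ?thesis by blast
  qed
  have lim_\<phi>: "(\<lambda>k. \<phi> k (\<i> * s)) \<longlonglongrightarrow> exp ((\<i> * s)\<^sup>2 / 2)"
  proof (rule ccontr)
    assume "\<not> ?thesis"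
    then obtain e where e: "e > 0"
      and ne: "\<not> (\<forall>\<^sub>F k in sequentially. dist (\<phi> k (\<i> * s)) (exp ((\<i> * s)\<^sup>2 / 2)) < e)"
      by (auto simp: tendsto_iff)
    obtain r :: "nat \<Rightarrow> nat" where r: "strict_mono r"
      and far: "\<And>n. \<not> dist (\<phi> (r n) (\<i> * s)) (exp ((\<i> * s)\<^sup>2 / 2)) < e"
      using not_eventually_sequentiallyD[OF ne] by blast
    obtain g r' where g: "g holomorphic_on UNIV" and r': "strict_mono r'"
      and lim_g: "\<And>x. (\<lambda>n. (\<phi> \<circ> r) (r' n) x) \<longlonglongrightarrow> g x"
    proof (rule Montel[of UNIV "range \<phi>" "\<phi> \<circ> r"])
      show "open (UNIV :: complex set)" by simp
      show "\<And>h. h \<in> range \<phi> \<Longrightarrow> h holomorphic_on UNIV" using hol by auto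
      show "\<And>K. compact K \<Longrightarrow> K \<subseteq> UNIV \<Longrightarrow> \<exists>B. \<forall>h\<in>range \<phi>. \<forall>z\<in>K. cmod (h z) \<le> B"
        by (rule bounded)
      show "range (\<phi> \<circ> r) \<subseteq> range \<phi>" by auto
    qed auto
    have "g (\<i> * s) - exp ((\<i> * s)\<^sup>2 / 2) = 0"
    proof (rule analytic_continuation[of "\<lambda>w. g w - exp (w\<^sup>2 / 2)" UNIV "complex_of_real ` \<rat>" 0])
      show "(\<lambda>w. g w - exp (w\<^sup>2 / 2)) holomorphic_on UNIV"
        by (intro holomorphic_intros g) auto
      \<comment> \<open>The identity theorem needs an accumulation point of the set of agreement;
        these nonzero rationals accumulate at 0.\<close>
      have "(\<lambda>n. complex_of_real (1 / real (Suc n))) \<longlonglongrightarrow> complex_of_real 0"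
        by (intro tendsto_of_real LIMSEQ_Suc lim_1_over_n)
      thus "0 islimpt complex_of_real ` \<rat>"
        by (intro islimpt_sequential[THEN iffD2] exI[of _ "\<lambda>n. complex_of_real (1 / real (Suc n))"])
          (auto simp del: of_real_divide of_nat_Suc intro!: imageI Rats_divide)
      fix z assume "z \<in> complex_of_real ` \<rat>"
      then obtain t where t: "t \<in> \<rat>" "z = complex_of_real t" by blast
      have eq: "\<phi> k z = complex_of_real (LINT x|\<mu> k. exp (t * x))" for k
        unfolding \<phi>_def t by (simp add: exp_of_real flip: of_real_mult)
      have "(\<lambda>k. \<phi> k z) \<longlonglongrightarrow> complex_of_real (exp (t\<^sup>2 / 2))"
        unfolding eq by (intro tendsto_of_real lim t)
      moreover have "strict_mono (r \<circ> r')" using r r' by (rule strict_mono_o)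
      ultimately have "(\<lambda>n. \<phi> (r (r' n)) z) \<longlonglongrightarrow> complex_of_real (exp (t\<^sup>2 / 2))"
        using LIMSEQ_subseq_LIMSEQ[of "\<lambda>k. \<phi> k z" _ "r \<circ> r'"] by (simp add: o_def)
      with lim_g[of z] have "g z = complex_of_real (exp (t\<^sup>2 / 2))"
        by (auto intro: LIMSEQ_unique)
      thus "g z - exp (z\<^sup>2 / 2) = 0" by (simp add: t flip: exp_of_real)
    qed auto
    hence "(\<lambda>n. \<phi> (r (r' n)) (\<i> * s)) \<longlonglongrightarrow> exp ((\<i> * s)\<^sup>2 / 2)"
      using lim_g[of "\<i> * s"] by simp
    from tendstoD[OF this e] obtain n where
      "dist (\<phi> (r (r' n)) (\<i> * s)) (exp ((\<i> * s)\<^sup>2 / 2)) < e"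
      by (auto simp: eventually_sequentially)
    with far show False by blast
  qed
  have "char (\<mu> k) s = \<phi> k (\<i> * s)" for k
    by (simp add: char_def \<phi>_def mult.assoc)
  moreover have "char std_normal_distribution s = exp ((\<i> * s)\<^sup>2 / 2)"
    by (simp add: char_std_normal_distribution power_mult_distrib flip: exp_of_real)
  ultimately show "(\<lambda>k. char (\<mu> k) s) \<longlonglongrightarrow> char std_normal_distribution s"
    using lim_\<phi> by simp
qed

text \<open>With every point a continuity point of the limit, weak convergence yields convergence of
  the distribution functions at each z.\<close>

lemma isCont_cdf_std_normal: "isCont (cdf std_normal_distribution) x"
proof -
  interpret real_distribution std_normal_distribution by (rule real_dist_normal_dist)
  have "AE y in lborel. y \<noteq> x" by (rule AE_lborel_singleton)
  hence "emeasure std_normal_distribution {x} = 0"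
    by (subst emeasure_density)
       (auto simp: nn_integral_0_iff_AE elim!: eventually_mono split: split_indicator)
  thus ?thesis by (simp add: isCont_cdf measure_def)
qed

text \<open>Only finitely many values of the moment generating function are needed for a given accuracy,
  so that convergence in probability can be handled by a union bound.\<close>

corollary cdf_near_std_normal_of_mgf:
  fixes z \<epsilon> :: real
  assumes "\<epsilon> > 0"
  obtains T \<delta> where "finite T" "0 \<notin> T" "\<delta> > 0"
    "\<And>\<mu>. real_distribution \<mu> \<Longrightarrow> (\<And>t. integrable \<mu> (\<lambda>x. exp (t * x))) \<Longrightarrow>
       (\<And>t. t \<in> T \<Longrightarrow> \<bar>(LINT x|\<mu>. exp (t * x)) - exp (t\<^sup>2 / 2)\<bar> \<le> \<delta>) \<Longrightarrow>
       \<bar>cdf \<mu> z - cdf std_normal_distribution z\<bar> < \<epsilon>"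
proof -
  define good where "good \<mu> \<longleftrightarrow> real_distribution \<mu> \<and> (\<forall>t. integrable \<mu> (\<lambda>x. exp (t * x)))" for \<mu> :: "real measure"
  define near where "near T \<delta> \<mu> \<longleftrightarrow> (\<forall>t\<in>T. \<bar>(LINT x|\<mu>. exp (t * x)) - exp (t\<^sup>2 / 2)\<bar> \<le> \<delta>)"
    for T \<delta> and \<mu> :: "real measure"
  define q where "q = from_nat_into (\<rat> :: real set)"
  \<comment> \<open>If no k worked, counterexamples for k = 0, 1, 2, ... would form a sequence: each
    fixed rational is eventually tested, with tolerance tending to 0, so the transforms converge at
    all rationals while the distribution functions stay away from the limit. The argument 0 is left
    out because the transform is 1 there for every probability measure, and because
    \<open>psi_bar\<close> divides by t.\<close>
  have "\<exists>k. \<forall>\<mu>. good \<mu> \<longrightarrow> near (q ` {..k} - {0}) (1 / real (Suc k)) \<mu> \<longrightarrow>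
      \<bar>cdf \<mu> z - cdf std_normal_distribution z\<bar> < \<epsilon>"
  proof (rule ccontr)
    assume "\<not> ?thesis"
    then obtain \<mu> where good: "\<And>k. good (\<mu> k)"
      and near: "\<And>k. near (q ` {..k} - {0}) (1 / real (Suc k)) (\<mu> k)"
      and far: "\<And>k. \<bar>cdf (\<mu> k) z - cdf std_normal_distribution z\<bar> \<ge> \<epsilon>"
      by (metis not_less)
    have "weak_conv_m \<mu> std_normal_distribution"
    proof (rule weak_conv_std_normal_of_mgf)
      show "real_distribution (\<mu> k)" "integrable (\<mu> k) (\<lambda>x. exp (t * x))" for k t
        using good[of k] by (auto simp: good_def)
      fix t :: real assume "t \<in> \<rat>"
      then obtain i where i: "q i = t"
        unfolding q_def using from_nat_into_surj[OF countable_rat] by blast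
      show "(\<lambda>k. LINT x|\<mu> k. exp (t * x)) \<longlonglongrightarrow> exp (t\<^sup>2 / 2)"
      proof (cases "t = 0")
        case True
        interpret real_distribution "\<mu> k" for k using good[of k] by (simp add: good_def)
        show ?thesis by (simp add: True prob_space del: space_eq_univ)
      next
        case False
        have "\<forall>\<^sub>F k in sequentially. norm ((LINT x|\<mu> k. exp (t * x)) - exp (t\<^sup>2 / 2)) \<le> 1 / real (Suc k)"
          using eventually_ge_at_top[of i]
        proof eventually_elim
          case (elim k)
          hence "t \<in> q ` {..k} - {0}" using i False by auto
          with near[of k] show ?case by (simp add: near_def)
        qed
        thus ?thesis
          by (rule LIM_zero_cancel[OF Lim_null_comparison[OF _ LIMSEQ_Suc[OF lim_1_over_n]]])
      qed
    qed
    hence "(\<lambda>k. cdf (\<mu> k) z) \<longlonglongrightarrow> cdf std_normal_distribution z"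
      by (auto simp: weak_conv_m_def weak_conv_def isCont_cdf_std_normal)
    from tendstoD[OF this \<open>\<epsilon> > 0\<close>] obtain k where "dist (cdf (\<mu> k) z) (cdf std_normal_distribution z) < \<epsilon>"
      by (auto simp: eventually_sequentially)
    with far[of k] show False by (simp add: dist_real_def)
  qed
  then obtain k where k: "\<And>\<mu>. good \<mu> \<Longrightarrow> near (q ` {..k} - {0}) (1 / real (Suc k)) \<mu> \<Longrightarrow>
      \<bar>cdf \<mu> z - cdf std_normal_distribution z\<bar> < \<epsilon>" by blast
  show thesis
  proof (rule that[of "q ` {..k} - {0}" "1 / real (Suc k)"])
    fix \<mu> :: "real measure"
    assume \<mu>: "real_distribution \<mu>" "\<And>t. integrable \<mu> (\<lambda>x. exp (t * x))"
      "\<And>t. t \<in> q ` {..k} - {0} \<Longrightarrow>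
        \<bar>(LINT x|\<mu>. exp (t * x)) - exp (t\<^sup>2 / 2)\<bar> \<le> 1 / real (Suc k)"
    have "good \<mu>" unfolding good_def using \<mu>(1,2) by (intro conjI allI)
    moreover have "near (q ` {..k} - {0}) (1 / real (Suc k)) \<mu>"
      unfolding near_def by (intro ballI \<mu>(3))
    ultimately show "\<bar>cdf \<mu> z - cdf std_normal_distribution z\<bar> < \<epsilon>"
      by (rule k)
  qed simp_all
qed

section \<open>Densities close to the true one\<close>

lemma space_leb01 [simp]: "space leb01 = {0..1}"
  by (simp add: leb01_def space_restrict_space)

lemma prob_space_leb01: "prob_space leb01"
  by (rule prob_spaceI) (simp add: leb01_def space_restrict_space emeasure_restrict_space)

lemma densitiesD:
  assumes "f \<in> densities"
  shows "integrable leb01 f" "(LINT x|leb01. f x) = 1" "\<And>x. x \<in> {0..1} \<Longrightarrow> 0 \<le> f x"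
    "f \<in> borel_measurable leb01"
  using assms by (auto simp: densities_def has_bochner_integral_iff)

lemma AE_densities_nonneg: "f \<in> densities \<Longrightarrow> AE x in leb01. 0 \<le> f x"
  by (rule AE_I2) (simp add: densitiesD)

lemma ess_norm_finiteE:
  assumes "ess_norm g < \<infinity>"
  obtains K where "0 \<le> K" "AE x in leb01. \<bar>g x\<bar> \<le> ereal K"
proof -
  obtain K where K: "ess_norm g \<le> ereal K"
    using assms by (cases "ess_norm g") auto
  have "AE x in leb01. \<bar>g x\<bar> \<le> ess_norm g"
    unfolding ess_norm_def by (rule esssup_AE)
  hence "AE x in leb01. \<bar>g x\<bar> \<le> ereal (max 0 K)"
    by eventually_elim (use K in \<open>auto simp: max_def intro: order_trans\<close>)
  thus thesis by (intro that[of "max 0 K"]) auto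
qed

text \<open>\<open>ext_ln\<close> is infinite in modulus off the positive reals, so a finite
  essential bound excludes these values up to a null set.\<close>

lemma AE_pos_of_log_bounded:
  assumes "ess_norm (\<lambda>x. ext_ln (f x)) < \<infinity>"
  shows "AE x in leb01. 0 < f x"
proof -
  obtain K where "AE x in leb01. \<bar>ext_ln (f x)\<bar> \<le> ereal K"
    using ess_norm_finiteE[OF assms] by metis
  thus ?thesis
    by eventually_elim (auto simp: ext_ln_def split: if_splits)
qed

lemma integrable_density_mult:
  assumes f: "f \<in> densities" and g: "g \<in> borel_measurable leb01" "AE x in leb01. \<bar>g x\<bar> \<le> K"
  shows "integrable leb01 (\<lambda>x. f x * g x)"
proof (rule Bochner_Integration.integrable_bound)
  show "integrable leb01 (\<lambda>x. K * f x)" using densitiesD(1)[OF f] by simp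
  show "(\<lambda>x. f x * g x) \<in> borel_measurable leb01" using densitiesD(4)[OF f] g(1) by simp
  show "AE x in leb01. norm (f x * g x) \<le> norm (K * f x)"
    using g(2)
  proof eventually_elim
    case (elim x)
    thus ?case using mult_left_mono[of "\<bar>g x\<bar>" K "\<bar>f x\<bar>"] by (simp add: abs_mult mult.commute)
  qed
qed

lemma abs_integral_density_mult_le:
  assumes f: "f \<in> densities" and g: "g \<in> borel_measurable leb01" "AE x in leb01. \<bar>g x\<bar> \<le> K"
  shows "\<bar>LINT x|leb01. f x * g x\<bar> \<le> K"
proof -
  have "norm (LINT x|leb01. f x * g x) \<le> (LINT x|leb01. norm (f x * g x))"
    by (rule integral_norm_bound)
  also have "\<dots> \<le> (LINT x|leb01. K * f x)"
  proof (rule integral_mono_AE)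
    show "AE x in leb01. norm (f x * g x) \<le> K * f x"
      using g(2) AE_densities_nonneg[OF f]
      by eventually_elim (auto simp: abs_mult mult.commute[of K] intro!: mult_left_mono)
  qed (use integrable_density_mult[OF assms] densitiesD(1)[OF f] in auto)
  also have "\<dots> = K" using densitiesD(2)[OF f] by simp
  finally show ?thesis by simp
qed

text \<open>Where f vanishes and \<open>f\<^sub>0\<close> is positive, the integrand of
  \<open>V\<close> is infinite, so a finite \<open>V\<close> makes this set null. Off it,
  \<open>ext_ln\<close> and the library's \<open>ln\<close> agree up to the sign inside the square,
  and \<open>V\<close> becomes an ordinary integral.\<close>

lemma A1_AE_pos:
  assumes f0: "f\<^sub>0 \<in> densities" "AE x in leb01. 0 < f\<^sub>0 x" and f: "f \<in> A1 f\<^sub>0 u"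
  shows "AE x in leb01. 0 < f x"
    and "integrable leb01 (\<lambda>x. f\<^sub>0 x * (ln (f x / f\<^sub>0 x))\<^sup>2)"
    and "(LINT x|leb01. f\<^sub>0 x * (ln (f x / f\<^sub>0 x))\<^sup>2) \<le> u\<^sup>2"
proof -
  have fd: "f \<in> densities" and V: "V f\<^sub>0 f \<le> ennreal (u\<^sup>2)" using f by (auto simp: A1_def)
  have [measurable]: "f \<in> borel_measurable leb01" "f\<^sub>0 \<in> borel_measurable leb01"
    using fd f0 densitiesD by auto
  define g where "g x = ennreal (f\<^sub>0 x) * e2ennreal ((ext_ln (f\<^sub>0 x / f x))\<^sup>2)" for x
  have g_meas [measurable]: "g \<in> borel_measurable leb01"
    unfolding g_def ext_ln_def power2_eq_square by measurable
  have "(\<integral>\<^sup>+x. g x \<partial>leb01) \<noteq> \<infinity>"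
    using V by (auto simp: V_def g_def top_unique)
  hence "AE x in leb01. g x \<noteq> \<infinity>" by (intro nn_integral_PInf_AE) auto
  thus pos: "AE x in leb01. 0 < f x"
    using f0(2) AE_densities_nonneg[OF fd]
  proof eventually_elim
    case (elim x)
    show ?case
    proof (rule ccontr)
      assume "\<not> 0 < f x"
      hence "f x = 0" using elim by simp
      hence "(ext_ln (f\<^sub>0 x / f x))\<^sup>2 = \<infinity>" by (simp add: ext_ln_def power2_eq_square)
      thus False using elim by (simp add: g_def ennreal_mult_eq_top_iff)
    qed
  qed
  let ?l = "\<lambda>x. f\<^sub>0 x * (ln (f x / f\<^sub>0 x))\<^sup>2"
  have nonneg: "AE x in leb01. 0 \<le> ?l x"
    using f0(2) by eventually_elim simp
  have "(\<integral>\<^sup>+x. ennreal (?l x) \<partial>leb01) = (\<integral>\<^sup>+x. g x \<partial>leb01)"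
  proof (rule nn_integral_cong_AE)
    show "AE x in leb01. ennreal (?l x) = g x"
      using f0(2) pos
    proof eventually_elim
      case (elim x)
      hence "(ln (f\<^sub>0 x / f x))\<^sup>2 = (ln (f x / f\<^sub>0 x))\<^sup>2"
        by (simp add: ln_div power2_commute)
      with elim show ?case
        by (simp add: g_def ext_ln_def ennreal_mult)
    qed
  qed
  hence le: "(\<integral>\<^sup>+x. ennreal (?l x) \<partial>leb01) \<le> ennreal (u\<^sup>2)"
    using V by (simp add: V_def g_def)
  show int: "integrable leb01 ?l"
    by (rule integrableI_nonneg) (use nonneg le in \<open>auto intro: le_less_trans\<close>)
  show "(LINT x|leb01. ?l x) \<le> u\<^sup>2"
    using le nn_integral_eq_integral[OF int nonneg] by simp
qed

text \<open>\<open>\<bar>y\<bar> = y + 2 max 0 (- y)\<close>, \<open>1 - r \<le> - ln r\<close> and \<open>2 \<bar>l\<bar> \<le> l\<^sup>2 / v + v\<close>, the last one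
  in place of Cauchy-Schwarz.\<close>

lemma A1_L1_bound:
  assumes f0: "f\<^sub>0 \<in> densities" "AE x in leb01. 0 < f\<^sub>0 x" and f: "f \<in> A1 f\<^sub>0 u"
    and v: "0 < v" "\<bar>u\<bar> \<le> v"
  shows "(LINT x|leb01. \<bar>f x - f\<^sub>0 x\<bar>) \<le> 2 * v"
proof -
  have fd: "f \<in> densities" using f by (auto simp: A1_def)
  note int = densitiesD(1)[OF fd] densitiesD(1)[OF f0(1)] A1_AE_pos(2)[OF f0 f]
  let ?l = "\<lambda>x. f\<^sub>0 x * (ln (f x / f\<^sub>0 x))\<^sup>2"
  \<comment> \<open>Both densities have integral 1, so the difference in the first bracket
    integrates to 0. The two terms of the second bracket contribute at most v each. The strictly
    positive v stands in for the modulus of u, which may be 0 and could not be a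
    denominator.\<close>
  have "(LINT x|leb01. \<bar>f x - f\<^sub>0 x\<bar>) \<le> (LINT x|leb01. (f x - f\<^sub>0 x) + (?l x / v + v * f\<^sub>0 x))"
  proof (rule integral_mono_AE)
    show "AE x in leb01. \<bar>f x - f\<^sub>0 x\<bar> \<le> (f x - f\<^sub>0 x) + (?l x / v + v * f\<^sub>0 x)"
      using f0(2) A1_AE_pos(1)[OF f0 f]
    proof eventually_elim
      case (elim x)
      let ?L = "ln (f x / f\<^sub>0 x)"
      have "?L \<le> f x / f\<^sub>0 x - 1" using elim by (intro ln_le_minus_one) simp
      hence "- ?L * f\<^sub>0 x \<ge> - (f x / f\<^sub>0 x - 1) * f\<^sub>0 x"
        using elim by (intro mult_right_mono) auto
      moreover have "- (f x / f\<^sub>0 x - 1) * f\<^sub>0 x = f\<^sub>0 x - f x" using elim by (simp add: field_simps)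
      ultimately have "f\<^sub>0 x - f x \<le> - ?L * f\<^sub>0 x" by simp
      moreover have "f\<^sub>0 x * (2 * (- ?L)) \<le> f\<^sub>0 x * (?L\<^sup>2 / v + v)"
      proof (rule mult_left_mono)
        have "0 \<le> (?L + v)\<^sup>2 / v" using v by simp
        also have "\<dots> = ?L\<^sup>2 / v + v + 2 * ?L"
          using v by (simp add: power2_eq_square field_simps)
        finally show "2 * (- ?L) \<le> ?L\<^sup>2 / v + v" by simp
      qed (use elim in simp)
      moreover have "f\<^sub>0 x * (?L\<^sup>2 / v + v) = ?l x / v + v * f\<^sub>0 x" by (simp add: algebra_simps)
      moreover have "0 \<le> ?l x / v + v * f\<^sub>0 x" using elim v by simp
      ultimately show ?case by (simp add: abs_if algebra_simps)
    qed
  qed (use int in auto)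
  also have "\<dots> = (LINT x|leb01. ?l x) / v + v"
    using int densitiesD(2)[OF fd] densitiesD(2)[OF f0(1)] by simp
  also have "\<dots> \<le> v\<^sup>2 / v + v"
  proof -
    have "u\<^sup>2 \<le> v\<^sup>2" using v by (simp add: abs_le_square_iff[symmetric])
    hence "(LINT x|leb01. ?l x) \<le> v\<^sup>2" using A1_AE_pos(3)[OF f0 f] by linarith
    thus ?thesis using v by (intro add_right_mono divide_right_mono) auto
  qed
  finally show ?thesis using v by (simp add: power2_eq_square)
qed

text \<open>The L1 bound is paired with a bounded function. It is meant for two choices: a centered
  function, whose mean under f is then small, and its square, whose integral is then close to the
  true variance.\<close>

lemma A1_integral_diff_le:
  assumes f0: "f\<^sub>0 \<in> densities" "AE x in leb01. 0 < f\<^sub>0 x" and f: "f \<in> A1 f\<^sub>0 u"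
    and v: "0 < v" "\<bar>u\<bar> \<le> v"
    and g: "g \<in> borel_measurable leb01" "AE x in leb01. \<bar>g x\<bar> \<le> K" and K: "0 \<le> K"
  shows "\<bar>(LINT x|leb01. f x * g x) - F0 f\<^sub>0 g\<bar> \<le> 2 * v * K"
proof -
  have fd: "f \<in> densities" using f by (auto simp: A1_def)
  note int = integrable_density_mult[OF fd g] integrable_density_mult[OF f0(1) g]
  have "(LINT x|leb01. f x * g x) - F0 f\<^sub>0 g = (LINT x|leb01. f x * g x - f\<^sub>0 x * g x)"
    unfolding F0_def using int by simp
  also have "\<bar>\<dots>\<bar> \<le> (LINT x|leb01. \<bar>f x * g x - f\<^sub>0 x * g x\<bar>)"
    using integral_norm_bound[of leb01 "\<lambda>x. f x * g x - f\<^sub>0 x * g x"] by simp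
  also have "\<dots> \<le> (LINT x|leb01. K * \<bar>f x - f\<^sub>0 x\<bar>)"
  proof (rule integral_mono_AE)
    show "AE x in leb01. \<bar>f x * g x - f\<^sub>0 x * g x\<bar> \<le> K * \<bar>f x - f\<^sub>0 x\<bar>"
      using g(2)
      by eventually_elim (auto simp: abs_mult left_diff_distrib[symmetric] mult.commute[of K] intro!: mult_left_mono)
  qed (use int densitiesD(1)[OF fd] densitiesD(1)[OF f0(1)] in auto)
  also have "\<dots> \<le> K * (2 * v)"
    using A1_L1_bound[OF f0 f v] K by (simp add: mult_left_mono)
  finally show ?thesis by (simp add: mult_ac)
qed

section \<open>Second-order expansion of the logarithm of a Laplace transform\<close>

lemma abs_exp_minus_quadratic_le:
  fixes y :: real
  assumes "\<bar>y\<bar> \<le> 1"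
  shows "\<bar>exp (- y) - (1 - y + y\<^sup>2 / 2)\<bar> \<le> \<bar>y\<bar> ^ 3"
proof -
  obtain t where t: "\<bar>t\<bar> \<le> \<bar>- y\<bar>" "exp (- y) = (\<Sum>m<3. (- y) ^ m / fact m) + exp t / fact 3 * (- y) ^ 3"
    using Maclaurin_exp_le[of "- y" 3] by auto
  have "exp t \<le> exp 1" using t(1) assms by simp
  also have "\<dots> \<le> 3" by (rule exp_le)
  finally have "exp t / 6 \<le> 1" by simp
  have "exp (- y) - (1 - y + y\<^sup>2 / 2) = exp t / 6 * (- y) ^ 3"
    unfolding t(2) by (simp add: eval_nat_numeral)
  hence "\<bar>exp (- y) - (1 - y + y\<^sup>2 / 2)\<bar> = exp t / 6 * \<bar>y\<bar> ^ 3"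
    by (simp add: abs_mult power_abs)
  also have "\<dots> \<le> 1 * \<bar>y\<bar> ^ 3" by (rule mult_right_mono) (use \<open>exp t / 6 \<le> 1\<close> in auto)
  finally show ?thesis by simp
qed

text \<open>A Taylor expansion under the integral gives 1 - s a + s^2 b / 2 up to k^3 with k = |s|
  K, and ln (1 + y) = y + O(y^2) does the rest. The square (s a)^2 is kept apart instead of being
  bounded by k^2: for s of order 1 / \<surd>n, n k^2 does not tend to 0, whereas n (s a)^2 does when
  a is small. The threshold 1/6 is a convenient one that keeps y within 1/2, as the bound for the
  logarithm requires.\<close>

lemma log_laplace_expansion:
  assumes f: "f \<in> densities" and g: "g \<in> borel_measurable leb01" "AE x in leb01. \<bar>g x\<bar> \<le> K"
    and K: "0 \<le> K" and s: "\<bar>s\<bar> * K \<le> 1 / 6"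
  defines "a \<equiv> LINT x|leb01. f x * g x" and "b \<equiv> LINT x|leb01. f x * (g x)\<^sup>2"
  shows "\<bar>ln (LINT x|leb01. f x * exp (- (s * g x))) + s * a - s\<^sup>2 * b / 2\<bar> \<le>
      (\<bar>s\<bar> * K) ^ 3 + 4 * (s * a)\<^sup>2 + 16 * (s * K) ^ 4"
    and "0 < (LINT x|leb01. f x * exp (- (s * g x)))"
proof -
  define I where "I = (LINT x|leb01. f x * exp (- (s * g x)))"
  define k where "k = \<bar>s\<bar> * K"
  have k: "0 \<le> k" "k \<le> 1 / 6" using s K by (auto simp: k_def)
  have [measurable]: "g \<in> borel_measurable leb01" "f \<in> borel_measurable leb01"
    using g densitiesD f by auto
  have sg: "AE x in leb01. \<bar>s * g x\<bar> \<le> k"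
    using g(2) by eventually_elim (auto simp: abs_mult k_def intro: mult_left_mono)
  have g2: "AE x in leb01. \<bar>(g x)\<^sup>2\<bar> \<le> K\<^sup>2"
    using g(2) by eventually_elim (auto simp: abs_le_square_iff[symmetric])
  have "AE x in leb01. \<bar>exp (- (s * g x))\<bar> \<le> exp k" using sg by eventually_elim auto
  hence int_exp: "integrable leb01 (\<lambda>x. f x * exp (- (s * g x)))"
    by (intro integrable_density_mult[OF f]) auto
  have int: "integrable leb01 (\<lambda>x. f x * g x)" "integrable leb01 (\<lambda>x. f x * (g x)\<^sup>2)" "integrable leb01 f"
    using integrable_density_mult[OF f _ g2] integrable_density_mult[OF f g] densitiesD(1)[OF f] by auto
  define R where "R x = exp (- (s * g x)) - (1 - s * g x + (s * g x)\<^sup>2 / 2)" for x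
  have "AE x in leb01. \<bar>R x\<bar> \<le> k ^ 3"
    using sg
  proof eventually_elim
    case (elim x)
    hence "\<bar>R x\<bar> \<le> \<bar>s * g x\<bar> ^ 3" unfolding R_def using k by (intro abs_exp_minus_quadratic_le) simp
    also have "\<dots> \<le> k ^ 3" using elim by (intro power_mono) auto
    finally show ?case .
  qed
  hence "\<bar>LINT x|leb01. f x * R x\<bar> \<le> k ^ 3"
    by (intro abs_integral_density_mult_le[OF f]) (auto simp: R_def)
  moreover have "(LINT x|leb01. f x * R x) = I - (1 - s * a + s\<^sup>2 * b / 2)"
  proof -
    have "(LINT x|leb01. f x * R x) =
      (LINT x|leb01. f x * exp (- (s * g x)) - (f x - s * (f x * g x) + s\<^sup>2 / 2 * (f x * (g x)\<^sup>2)))"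
      by (intro Bochner_Integration.integral_cong refl) (simp add: R_def algebra_simps power_mult_distrib)
    also have "\<dots> = I - (1 - s * a + s\<^sup>2 / 2 * b)"
      using int int_exp densitiesD(2)[OF f] by (simp add: I_def a_def b_def)
    finally show ?thesis by simp
  qed
  ultimately have r: "\<bar>I - (1 - s * a + s\<^sup>2 * b / 2)\<bar> \<le> k ^ 3" by simp
  have "\<bar>a\<bar> \<le> K" unfolding a_def by (rule abs_integral_density_mult_le[OF f g])
  hence sa: "\<bar>s * a\<bar> \<le> k" by (simp add: abs_mult k_def mult_left_mono)
  have "\<bar>b\<bar> \<le> K\<^sup>2" unfolding b_def by (rule abs_integral_density_mult_le[OF f _ g2]) simp
  hence "\<bar>s\<^sup>2 * b\<bar> \<le> s\<^sup>2 * K\<^sup>2" by (simp add: abs_mult mult_left_mono)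
  hence sb: "\<bar>s\<^sup>2 * b\<bar> \<le> k\<^sup>2" by (simp add: k_def power_mult_distrib)
  \<comment> \<open>Removing the linear term leaves a quantity of order k^2, whose square
    contributes only k^4. The part of y^2 that has second order is thus confined to (s a)^2.\<close>
  define q where "q = I - 1 + s * a"
  have k3: "k ^ 3 \<le> k\<^sup>2 / 6" using mult_left_mono[OF k(2), of "k\<^sup>2"] by (simp add: eval_nat_numeral)
  hence q: "\<bar>q\<bar> \<le> 2 * k\<^sup>2" using r sb unfolding q_def by (simp add: abs_le_iff)
  have k2: "k\<^sup>2 \<le> k / 6" using mult_left_mono[OF k(2), of k] k by (simp add: power2_eq_square)
  define y where "y = I - 1"
  have y: "y = q - s * a" by (simp add: y_def q_def)
  have "\<bar>y\<bar> \<le> 2 * k\<^sup>2 + k" unfolding y using q sa by linarith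
  also have "\<dots> \<le> 1 / 2" using k k2 by simp
  finally have y_half: "\<bar>y\<bar> \<le> 1 / 2" .
  thus "0 < (LINT x|leb01. f x * exp (- (s * g x)))"
    unfolding y_def I_def by linarith
  have "\<bar>ln (1 + y) - y\<bar> \<le> 2 * y\<^sup>2" by (rule abs_ln_one_plus_x_minus_x_bound[OF y_half])
  also have "y\<^sup>2 \<le> 2 * q\<^sup>2 + 2 * (s * a)\<^sup>2"
    unfolding y using sum_squares_bound[of q "- (s * a)"] by (simp add: power2_diff)
  also have "q\<^sup>2 \<le> 4 * k ^ 4"
    using power_mono[OF q, of 2] by (simp add: power_mult_distrib flip: power_mult)
  finally have "\<bar>ln I - y\<bar> \<le> 16 * k ^ 4 + 4 * (s * a)\<^sup>2" by (simp add: y_def)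
  hence "\<bar>ln I + s * a - s\<^sup>2 * b / 2\<bar> \<le> k ^ 3 + 4 * (s * a)\<^sup>2 + 16 * k ^ 4"
    using r unfolding y_def by linarith
  moreover have "k ^ 4 = (s * K) ^ 4" by (simp add: k_def power_mult_distrib)
  ultimately show "\<bar>ln (LINT x|leb01. f x * exp (- (s * g x))) + s * a - s\<^sup>2 * b / 2\<bar> \<le>
      (\<bar>s\<bar> * K) ^ 3 + 4 * (s * a)\<^sup>2 + 16 * (s * K) ^ 4"
    by (simp add: I_def k_def)
qed

text \<open>This is n times the previous expansion at s = t / \<surd>n. The four error terms come,
  in this order, from the cubic Taylor remainder, from the squared second-order part in the
  logarithm, from the squared mean of g under f, which is O(v) since g is centered under
  \<open>f\<^sub>0\<close>, and from replacing the second moment under f by the one under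
  \<open>f\<^sub>0\<close>.\<close>

lemma log_laplace_A1:
  fixes n :: nat and s :: real
  assumes f0: "f\<^sub>0 \<in> densities" "AE x in leb01. 0 < f\<^sub>0 x" and f: "f \<in> A1 f\<^sub>0 u"
    and v: "0 < v" "\<bar>u\<bar> \<le> v"
    and g: "g \<in> borel_measurable leb01" "AE x in leb01. \<bar>g x\<bar> \<le> K" and K: "0 \<le> K"
    and g0: "F0 f\<^sub>0 g = 0" and n: "n > 0" and t: "\<bar>t\<bar> * K \<le> sqrt (real n) / 6"
  shows "\<bar>real n * ln (LINT x|leb01. f x * exp (- (t / sqrt (real n) * g x)))
      + sqrt (real n) * t * (LINT x|leb01. f x * g x) - t\<^sup>2 * F0 f\<^sub>0 (\<lambda>x. (g x)\<^sup>2) / 2\<bar>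
    \<le> (\<bar>t\<bar> * K) ^ 3 / sqrt (real n) + 16 * (t * K) ^ 4 / real n + 16 * (t * v * K)\<^sup>2 + (t * K)\<^sup>2 * v"
proof -
  define s where "s = t / sqrt (real n)"
  define a where "a = (LINT x|leb01. f x * g x)"
  define b where "b = (LINT x|leb01. f x * (g x)\<^sup>2)"
  define I where "I = (LINT x|leb01. f x * exp (- (s * g x)))"
  define b0 where "b0 = F0 f\<^sub>0 (\<lambda>x. (g x)\<^sup>2)"
  define m where "m = sqrt (real n)"
  have m: "0 < m" "real n = m\<^sup>2" using n by (auto simp: m_def)
  have fd: "f \<in> densities" using f by (auto simp: A1_def)
  have g2: "AE x in leb01. \<bar>(g x)\<^sup>2\<bar> \<le> K\<^sup>2"
    using g(2) by eventually_elim (auto simp: abs_le_square_iff[symmetric])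
  have sK: "\<bar>s\<bar> * K \<le> 1 / 6" using t m by (simp add: s_def m_def[symmetric] field_simps)
  have "\<bar>ln I + s * a - s\<^sup>2 * b / 2\<bar> \<le> (\<bar>s\<bar> * K) ^ 3 + 4 * (s * a)\<^sup>2 + 16 * (s * K) ^ 4"
    unfolding I_def a_def b_def by (rule log_laplace_expansion[OF fd g K sK])
  hence "m\<^sup>2 * \<bar>ln I + s * a - s\<^sup>2 * b / 2\<bar> \<le> m\<^sup>2 * ((\<bar>s\<bar> * K) ^ 3 + 4 * (s * a)\<^sup>2 + 16 * (s * K) ^ 4)"
    using m by (intro mult_left_mono) auto
  moreover have "m\<^sup>2 * \<bar>ln I + s * a - s\<^sup>2 * b / 2\<bar> = \<bar>m\<^sup>2 * ln I + m * t * a - t\<^sup>2 * b / 2\<bar>"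
  proof -
    have "m\<^sup>2 * (ln I + s * a - s\<^sup>2 * b / 2) = m\<^sup>2 * ln I + m * t * a - t\<^sup>2 * b / 2"
      using m(1) by (simp add: s_def m_def[symmetric] field_simps power2_eq_square)
    thus ?thesis using abs_mult[of "m\<^sup>2" "ln I + s * a - s\<^sup>2 * b / 2"] m by simp
  qed
  moreover have "m\<^sup>2 * ((\<bar>s\<bar> * K) ^ 3 + 4 * (s * a)\<^sup>2 + 16 * (s * K) ^ 4)
      = (\<bar>t\<bar> * K) ^ 3 / m + 4 * (t * a)\<^sup>2 + 16 * (t * K) ^ 4 / m\<^sup>2"
    using m(1) by (simp add: s_def m_def[symmetric] field_simps eval_nat_numeral)
  ultimately have 1: "\<bar>m\<^sup>2 * ln I + m * t * a - t\<^sup>2 * b / 2\<bar>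
      \<le> (\<bar>t\<bar> * K) ^ 3 / m + 4 * (t * a)\<^sup>2 + 16 * (t * K) ^ 4 / m\<^sup>2" by linarith
  have "\<bar>a\<bar> \<le> 2 * v * K"
    using A1_integral_diff_le[OF f0 f v g K] g0 by (simp add: a_def)
  hence "\<bar>t * a\<bar> \<le> \<bar>t * (2 * v * K)\<bar>"
    using v K by (simp add: abs_mult mult_left_mono)
  hence "(t * a)\<^sup>2 \<le> (t * (2 * v * K))\<^sup>2" by (simp only: abs_le_square_iff)
  hence 2: "4 * (t * a)\<^sup>2 \<le> 16 * (t * v * K)\<^sup>2" by (simp add: power_mult_distrib mult_ac)
  have "\<bar>b - b0\<bar> \<le> 2 * v * K\<^sup>2"
    unfolding b_def b0_def using A1_integral_diff_le[OF f0 f v _ g2] g(1) by simp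
  hence "t\<^sup>2 * \<bar>b - b0\<bar> \<le> t\<^sup>2 * (2 * v * K\<^sup>2)" by (intro mult_left_mono) auto
  moreover have "t\<^sup>2 * \<bar>b - b0\<bar> = \<bar>t\<^sup>2 * b - t\<^sup>2 * b0\<bar>"
    by (simp add: abs_mult right_diff_distrib[symmetric])
  ultimately have 3: "\<bar>t\<^sup>2 * b / 2 - t\<^sup>2 * b0 / 2\<bar> \<le> (t * K)\<^sup>2 * v"
    by (simp add: power_mult_distrib mult_ac)
  have "\<bar>m\<^sup>2 * ln I + m * t * a - t\<^sup>2 * b0 / 2\<bar>
      \<le> (\<bar>t\<bar> * K) ^ 3 / m + 16 * (t * K) ^ 4 / m\<^sup>2 + 16 * (t * v * K)\<^sup>2 + (t * K)\<^sup>2 * v"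
    using 1 2 3 by linarith
  thus ?thesis
    unfolding I_def s_def a_def b0_def m(2)[symmetric] m_def[symmetric] .
qed

section \<open>The shifted weights and the posterior\<close>

text \<open>\<open>Rn\<close> restores the centering that \<open>Gn\<close> subtracts and cancels
  the quadratic term. The cancellation is an identity between real numbers, valid whatever values
  the integrals take.\<close>

lemma lan_weight_eq:
  assumes "n > 0"
  shows "lan_weight f\<^sub>0 n x g = exp ((\<Sum>i<n. g (x i)) / sqrt (real n))"
proof -
  have "sqrt (real n) * F0 f\<^sub>0 g = real n * F0 f\<^sub>0 g / sqrt (real n)"
    using assms by (simp add: field_simps)
  thus ?thesis
    by (simp add: lan_weight_def Gn_def Rn_def sum_subtractf diff_divide_distrib)
qed

text \<open>Positivity at the sample points matters: as \<open>ln 0 = 0\<close>, an observation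
  where f vanishes would contribute a factor 1 instead of 0.\<close>

lemma lan_weight_h_of:
  assumes n: "n > 0" and pos: "\<And>i. i < n \<Longrightarrow> 0 < f\<^sub>0 (x i)" "\<And>i. i < n \<Longrightarrow> 0 < f (x i)"
  shows "lan_weight f\<^sub>0 n x (h_of f\<^sub>0 n f) = likelihood n x f / likelihood n x f\<^sub>0"
proof -
  have "(\<Sum>i<n. h_of f\<^sub>0 n f (x i)) / sqrt (real n) = (\<Sum>i<n. ln (f (x i) / f\<^sub>0 (x i)))"
    using n by (simp add: h_of_def sum_distrib_left[symmetric])
  also have "exp \<dots> = (\<Prod>i<n. f (x i) / f\<^sub>0 (x i))"
    using pos by (simp add: exp_sum)
  finally show ?thesis
    using lan_weight_eq[OF n] by (simp add: likelihood_def prod_dividef)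
qed

section \<open>Measurability over the prior, and Bayes' formula\<close>

lemma measurable_prior_eval:
  assumes "prior \<pi>" and [measurable]: "g \<in> measurable N \<pi>" "h \<in> measurable N leb01"
  shows "(\<lambda>w. (g w) (h w)) \<in> borel_measurable N"
proof -
  have "(\<lambda>(f, x). f x) \<in> borel_measurable (\<pi> \<Otimes>\<^sub>M leb01)" using assms(1) by (simp add: prior_def)
  from measurable_compose[OF _ this, of "\<lambda>w. (g w, h w)" N] show ?thesis by simp
qed

lemma measurable_likelihood:
  assumes \<pi>: "prior \<pi>" and "g \<in> measurable N \<pi>" and "\<And>i. i < n \<Longrightarrow> (\<lambda>w. x w i) \<in> measurable N leb01"
  shows "(\<lambda>w. likelihood n (x w) (g w)) \<in> borel_measurable N"
  unfolding likelihood_def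
  by (intro borel_measurable_prod measurable_prior_eval[OF \<pi>] assms) simp

text \<open>Joint measurability of evaluation makes a parametrized integral over the unit interval
  measurable in f. This covers \<open>Psi\<close> and the normalizing constant in
  \<open>psi_bar\<close>.\<close>

lemma measurable_prior_integral:
  fixes \<phi> :: "real \<Rightarrow> real \<Rightarrow> real"
  assumes \<pi>: "prior \<pi>" and \<phi>: "case_prod \<phi> \<in> borel_measurable (borel \<Otimes>\<^sub>M leb01)"
  shows "(\<lambda>f. LINT y|leb01. \<phi> (f y) y) \<in> borel_measurable \<pi>"
proof -
  interpret prob_space leb01 by (rule prob_space_leb01)
  have "(\<lambda>w. (fst w (snd w), snd w)) \<in> measurable (\<pi> \<Otimes>\<^sub>M leb01) (borel \<Otimes>\<^sub>M leb01)"
    by (intro measurable_Pair measurable_prior_eval[OF \<pi>]) auto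
  from measurable_compose[OF this \<phi>]
  have "(\<lambda>(f, y). \<phi> (f y) y) \<in> borel_measurable (\<pi> \<Otimes>\<^sub>M leb01)"
    by (simp add: case_prod_beta')
  thus ?thesis by (rule borel_measurable_lebesgue_integral)
qed

lemma likelihood_nonneg:
  assumes "prior \<pi>" "f \<in> space \<pi>" "\<forall>i<n. x i \<in> {0..1}"
  shows "0 \<le> likelihood n x f"
  using assms densitiesD(3)[of f] unfolding likelihood_def prior_def
  by (intro prod_nonneg) blast

text \<open>If the integrated likelihood is 0 or infinite, the conventions for division in
  \<open>ennreal\<close> turn the posterior into the zero measure. So one set of nonzero posterior
  mass certifies that Bayes' formula holds with a finite positive denominator, and (A2) supplies
  such a set with probability tending to 1.\<close>

lemma posterior_normalized:
  assumes \<pi>: "prior \<pi>" and x: "\<forall>i<n. x i \<in> {0..1}" and nz: "measure (posterior \<pi> n x) S \<noteq> 0"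
    and S: "S \<in> sets \<pi>"
  shows "integrable \<pi> (likelihood n x)" and "0 < (LINT f|\<pi>. likelihood n x f)"
    and "\<And>B. B \<in> sets \<pi> \<Longrightarrow> measure (posterior \<pi> n x) B =
      (LINT f|\<pi>. indicator B f * likelihood n x f) / (LINT f|\<pi>. likelihood n x f)"
proof -
  let ?L = "likelihood n x"
  have L [measurable]: "?L \<in> borel_measurable \<pi>"
    using measurable_likelihood[OF \<pi>, of "\<lambda>f. f" \<pi> n "\<lambda>_. x"] x by (simp add: measurable_const)
  have nonneg: "AE f in \<pi>. 0 \<le> ?L f" by (rule AE_I2) (rule likelihood_nonneg[OF \<pi> _ x])
  define D where "D = (\<integral>\<^sup>+g. ennreal (?L g) \<partial>\<pi>)"
  have emeasure: "emeasure (posterior \<pi> n x) B = (\<integral>\<^sup>+f. ennreal (?L f) / D * indicator B f \<partial>\<pi>)"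
    if "B \<in> sets \<pi>" for B
    using that by (simp add: posterior_def D_def emeasure_density)
  have "D \<noteq> \<infinity>"
  proof
    assume "D = \<infinity>"
    hence "emeasure (posterior \<pi> n x) S = 0" by (simp add: emeasure S divide_ennreal_def)
    with nz show False by (simp add: measure_def)
  qed
  have "D \<noteq> 0"
  proof
    assume "D = 0"
    hence "AE f in \<pi>. ennreal (?L f) = 0" by (simp add: D_def nn_integral_0_iff_AE)
    hence "AE f in \<pi>. ennreal (?L f) / D * indicator S f = 0" by eventually_elim simp
    hence "emeasure (posterior \<pi> n x) S = (\<integral>\<^sup>+f. 0 \<partial>\<pi>)"
      unfolding emeasure[OF S] by (rule nn_integral_cong_AE)
    with nz show False by (simp add: measure_def)
  qed
  show int: "integrable \<pi> ?L"
    by (rule integrableI_nonneg[OF L nonneg]) (use \<open>D \<noteq> \<infinity>\<close> in \<open>simp add: D_def less_top\<close>)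
  define d where "d = (LINT f|\<pi>. ?L f)"
  have D: "D = ennreal d"
    unfolding D_def d_def by (rule nn_integral_eq_integral[OF int nonneg])
  with \<open>D \<noteq> 0\<close> show d: "0 < (LINT f|\<pi>. ?L f)"
    using ennreal_eq_0_iff[of d] by (simp add: d_def)
  fix B assume B [measurable]: "B \<in> sets \<pi>"
  have int_B: "integrable \<pi> (\<lambda>f. indicator B f * ?L f)"
    using integrable_real_mult_indicator[OF B int] by (simp add: mult.commute)
  have "emeasure (posterior \<pi> n x) B = (\<integral>\<^sup>+f. ennreal (indicator B f * ?L f / d) \<partial>\<pi>)"
    unfolding emeasure[OF B] D
  proof (rule nn_integral_cong_AE)
    show "AE f in \<pi>. ennreal (?L f) / ennreal d * indicator B f = ennreal (indicator B f * ?L f / d)"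
      using nonneg by eventually_elim (use d in \<open>auto simp: d_def divide_ennreal split: split_indicator\<close>)
  qed
  also have "\<dots> = ennreal (LINT f|\<pi>. indicator B f * ?L f / d)"
    by (rule nn_integral_eq_integral)
       (use int_B nonneg d in \<open>auto simp: d_def elim!: eventually_mono\<close>)
  also have "(LINT f|\<pi>. indicator B f * ?L f / d) = (LINT f|\<pi>. indicator B f * ?L f) / d"
    by simp
  finally show "measure (posterior \<pi> n x) B = (LINT f|\<pi>. indicator B f * ?L f) / (LINT f|\<pi>. ?L f)"
    unfolding measure_def using nonneg d
    by (simp add: d_def enn2real_ennreal) (intro enn2real_ennreal divide_nonneg_pos integral_nonneg_AE, auto elim!: eventually_mono)
qed

section \<open>The shifted weight as an exponentially tilted likelihood ratio\<close>

locale bvm_model =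
  fixes f\<^sub>0 \<psi> :: "real \<Rightarrow> real" and \<pi> :: "(real \<Rightarrow> real) measure" and K :: real
  assumes f0: "f\<^sub>0 \<in> densities" and f0_pos: "AE x in leb01. 0 < f\<^sub>0 x"
    and psi [measurable]: "\<psi> \<in> borel_measurable leb01" and psi_le: "AE x in leb01. \<bar>\<psi> x\<bar> \<le> K"
    and K: "0 \<le> K"
    and prior: "prior \<pi>"
begin

sublocale \<pi>: prob_space \<pi> using prior by (simp add: prior_def)

lemma f0_measurable [measurable]: "f\<^sub>0 \<in> borel_measurable leb01"
  by (rule densitiesD(4)[OF f0])

lemma psi_c_measurable [measurable]: "psi_c f\<^sub>0 \<psi> \<in> borel_measurable leb01"
  unfolding psi_c_def[abs_def] by measurable

lemma psi_c_le: "AE x in leb01. \<bar>psi_c f\<^sub>0 \<psi> x\<bar> \<le> 2 * K"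
proof -
  have "\<bar>F0 f\<^sub>0 \<psi>\<bar> \<le> K" unfolding F0_def by (rule abs_integral_density_mult_le[OF f0 psi psi_le])
  with psi_le show ?thesis by (auto simp: psi_c_def elim!: eventually_mono)
qed

lemma integral_psi_c:
  assumes f: "f \<in> densities"
  shows "(LINT x|leb01. f x * psi_c f\<^sub>0 \<psi> x) = Psi \<psi> f - F0 f\<^sub>0 \<psi>"
  using integrable_density_mult[OF f psi psi_le] densitiesD(1,2)[OF f]
  by (simp add: psi_c_def Psi_def right_diff_distrib)

lemma F0_psi_c: "F0 f\<^sub>0 (psi_c f\<^sub>0 \<psi>) = 0"
  using integral_psi_c[OF f0] by (simp add: F0_def Psi_def)

definition dev :: "nat \<Rightarrow> (nat \<Rightarrow> real) \<Rightarrow> (real \<Rightarrow> real) \<Rightarrow> real" where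
  "dev n x f = sqrt (real n) * (Psi \<psi> f - Pn n x \<psi>)"

definition \<sigma>2 :: real where "\<sigma>2 = F0 f\<^sub>0 (\<lambda>x. (psi_c f\<^sub>0 \<psi> x)\<^sup>2)"

text \<open>This is the error in \<open>log_laplace_A1\<close> for \<open>psi_c\<close>, which is
  bounded by 2 K. It depends on f only through v, which is the uniformity over the set in
  (A2).\<close>

definition remainder :: "nat \<Rightarrow> real \<Rightarrow> real \<Rightarrow> real" where
  "remainder n t v = (\<bar>t\<bar> * (2 * K)) ^ 3 / sqrt (real n) + 16 * (t * (2 * K)) ^ 4 / real n
     + 16 * (t * v * (2 * K))\<^sup>2 + (t * (2 * K))\<^sup>2 * v"

lemma remainder_tendsto:
  assumes "v \<longlonglongrightarrow> 0"
  shows "(\<lambda>n. remainder n t (v n)) \<longlonglongrightarrow> 0"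
proof -
  have "(\<lambda>n. (\<bar>t\<bar> * (2 * K)) ^ 3 / sqrt (real n)) \<longlonglongrightarrow> 0"
    "(\<lambda>n. 16 * (t * (2 * K)) ^ 4 / real n) \<longlonglongrightarrow> 0"
    by (intro tendsto_divide_0[OF tendsto_const] filterlim_at_top_imp_at_infinity
        filterlim_compose[OF sqrt_at_top] filterlim_real_sequentially)+
  moreover have "(\<lambda>n. 16 * (t * v n * (2 * K))\<^sup>2 + (t * (2 * K))\<^sup>2 * v n)
      \<longlonglongrightarrow> 16 * (t * 0 * (2 * K))\<^sup>2 + (t * (2 * K))\<^sup>2 * 0"
    by (intro tendsto_intros assms)
  ultimately have "(\<lambda>n. (\<bar>t\<bar> * (2 * K)) ^ 3 / sqrt (real n) + 16 * (t * (2 * K)) ^ 4 / real n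
     + (16 * (t * v n * (2 * K))\<^sup>2 + (t * (2 * K))\<^sup>2 * v n)) \<longlonglongrightarrow> 0 + 0 + 0"
    by (intro tendsto_add) simp_all
  thus ?thesis by (simp add: remainder_def[abs_def] add.assoc)
qed

text \<open>The quadratic terms of \<^const>\<open>lan_weight\<close> cancel, so the shifted weight is the
  likelihood ratio times \<open>exp (- t / \<surd>n \<Sum>\<psi>\<^sub>c(X\<^sub>i))\<close> and the power \<open>- n\<close> of the normalizing
  constant in \<^const>\<open>psi_bar\<close>.\<close>

lemma lan_weight_shift:
  assumes n: "n > 0" and t: "t \<noteq> 0" and v: "0 < v" "\<bar>u\<bar> \<le> v" and nt: "\<bar>t\<bar> * (2 * K) \<le> sqrt (real n) / 6"
    and f: "f \<in> A1 f\<^sub>0 u"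
    and pos: "\<And>i. i < n \<Longrightarrow> 0 < f\<^sub>0 (x i)" "\<And>i. i < n \<Longrightarrow> 0 < f (x i)"
  obtains \<rho> where "\<bar>\<rho>\<bar> \<le> remainder n t v"
    and "lan_weight f\<^sub>0 n x (\<lambda>y. h_of f\<^sub>0 n f y - t * psi_bar f\<^sub>0 \<psi> t n (h_of f\<^sub>0 n f) y) =
      likelihood n x f / likelihood n x f\<^sub>0 * exp (t * dev n x f - t\<^sup>2 * \<sigma>2 / 2 + \<rho>)"
proof -
  let ?p = "psi_c f\<^sub>0 \<psi>" and ?h = "h_of f\<^sub>0 n f"
  define m where "m = sqrt (real n)"
  have m: "m > 0" "real n = m * m" using n by (auto simp: m_def)
  have fd: "f \<in> densities" using f by (auto simp: A1_def)
  have f_meas [measurable]: "f \<in> borel_measurable leb01" by (rule densitiesD(4)[OF fd])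
  define I where "I = (LINT y|leb01. f y * exp (- (t / m * ?p y)))"
  \<comment> \<open>Since \<open>f\<^sub>0\<close> exp (h / \<surd>n) is f almost everywhere, the
    constant in \<open>psi_bar\<close> is a Laplace transform under f itself.\<close>
  have "F0 f\<^sub>0 (\<lambda>y. exp (?h y / m - t * ?p y / m)) = I"
    unfolding F0_def I_def
  proof (rule integral_cong_AE)
    show "AE y in leb01. f\<^sub>0 y * exp (?h y / m - t * ?p y / m) = f y * exp (- (t / m * ?p y))"
      using f0_pos A1_AE_pos(1)[OF f0 f0_pos f]
    proof eventually_elim
      case (elim y)
      have "exp (?h y / m - t * ?p y / m) = exp (ln (f y / f\<^sub>0 y)) * exp (- (t / m * ?p y))"
        using m by (simp add: h_of_def m_def[symmetric] flip: exp_add)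
      thus ?case using elim by simp
    qed
  qed (auto simp: h_of_def[abs_def])
  hence bar: "psi_bar f\<^sub>0 \<psi> t n ?h y = ?p y + m / t * ln I" for y
    by (simp add: psi_bar_def m_def)
  have "(\<Sum>i<n. ?h (x i) - t * psi_bar f\<^sub>0 \<psi> t n ?h (x i)) =
      (\<Sum>i<n. ?h (x i)) - t * (\<Sum>i<n. ?p (x i)) - real n * (m * ln I)"
    unfolding bar using t by (simp add: sum_subtractf sum.distrib algebra_simps sum_distrib_left)
  hence "(\<Sum>i<n. ?h (x i) - t * psi_bar f\<^sub>0 \<psi> t n ?h (x i)) / m =
      (\<Sum>i<n. ?h (x i)) / m - t / m * (\<Sum>i<n. ?p (x i)) - real n * ln I"
    using m by (simp add: diff_divide_distrib)
  moreover have "lan_weight f\<^sub>0 n x ?h = likelihood n x f / likelihood n x f\<^sub>0"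
    using n pos by (rule lan_weight_h_of)
  ultimately have w: "lan_weight f\<^sub>0 n x (\<lambda>y. ?h y - t * psi_bar f\<^sub>0 \<psi> t n ?h y) =
      likelihood n x f / likelihood n x f\<^sub>0 * exp (- (t / m * (\<Sum>i<n. ?p (x i))) - real n * ln I)"
    unfolding lan_weight_eq[OF n] m_def[symmetric]
    by (metis (no_types, lifting) diff_conv_add_uminus add.assoc exp_add)
  define \<rho> where "\<rho> = - (real n * ln I + m * t * (LINT y|leb01. f y * ?p y) - t\<^sup>2 * \<sigma>2 / 2)"
  have "\<bar>\<rho>\<bar> \<le> remainder n t v"
    unfolding \<rho>_def I_def m_def \<sigma>2_def remainder_def abs_minus_cancel
    by (rule log_laplace_A1[OF f0 f0_pos f v psi_c_measurable psi_c_le _ F0_psi_c n nt]) (use K in simp)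
  \<comment> \<open>The sample sum is centered at \<open>F0 f\<^sub>0 \<psi>\<close>, and so is the
    linear term in \<rho>. The two centerings cancel, and the difference is exactly t times
    \<open>dev\<close>.\<close>
  moreover have "(\<Sum>i<n. ?p (x i)) = real n * (Pn n x \<psi> - F0 f\<^sub>0 \<psi>)"
    using n by (simp add: psi_c_def sum_subtractf Pn_def right_diff_distrib)
  hence "t / m * (\<Sum>i<n. ?p (x i)) = t * m * (Pn n x \<psi> - F0 f\<^sub>0 \<psi>)"
    using m by simp
  hence "- (t / m * (\<Sum>i<n. ?p (x i))) - real n * ln I = t * dev n x f - t\<^sup>2 * \<sigma>2 / 2 + \<rho>"
    unfolding \<rho>_def integral_psi_c[OF fd] by (simp add: dev_def m_def[symmetric] algebra_simps)
  ultimately show thesis using w by (intro that[of \<rho>]) simp_all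
qed

end

text \<open>Here m stands for a Laplace transform, r for the ratio in (A3), e for the Gaussian value
  and R for the remainder. The factor 5 is enough because (1 + 2 \<eta>) (1 + \<eta>) \<le> 1 + 5
  \<eta> for \<eta> \<le> 1.\<close>

lemma mgf_error_le:
  fixes m r e \<eta> R \<delta> :: real
  assumes \<eta>: "0 < \<eta>" "\<eta> \<le> 1" and e: "0 < e" "5 * \<eta> * e \<le> \<delta>" and R: "R \<le> \<eta>" and r: "\<bar>r - 1\<bar> \<le> \<eta>"
    and m: "0 \<le> m" "exp (- R) * m \<le> r * e" "r * e \<le> exp R * m"
  shows "\<bar>m - e\<bar> \<le> \<delta>"
proof -
  have "exp R * (exp (- R) * m) \<le> exp R * (r * e)" using m(2) by (intro mult_left_mono) auto
  hence "m \<le> exp R * (r * e)" by (simp add: mult.assoc[symmetric] flip: exp_add)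
  also have "\<dots> \<le> (1 + 2 * \<eta>) * ((1 + \<eta>) * e)"
  proof (rule mult_mono)
    have "exp R \<le> exp \<eta>" using R by simp
    also have "\<dots> \<le> 1 + \<eta> + \<eta>\<^sup>2" using \<eta> by (intro exp_bound) auto
    also have "\<dots> \<le> 1 + 2 * \<eta>" using mult_left_mono[of \<eta> 1 \<eta>] \<eta> by (simp add: power2_eq_square)
    finally show "exp R \<le> 1 + 2 * \<eta>" .
    show "r * e \<le> (1 + \<eta>) * e" using r e by (intro mult_right_mono) auto
    show "0 \<le> r * e" using m(1,2) by (meson exp_ge_zero mult_nonneg_nonneg order_trans)
  qed (use \<eta> in auto)
  also have "\<dots> \<le> e + 5 * \<eta> * e"
  proof -
    have "\<eta> * \<eta> * e \<le> \<eta> * 1 * e" using \<eta> e by (intro mult_right_mono mult_left_mono) auto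
    thus ?thesis by (simp add: algebra_simps)
  qed
  finally have upper: "m - e \<le> \<delta>" using e by linarith
  have "(1 - \<eta>) * ((1 - \<eta>) * e) \<le> exp (- R) * (exp R * m)"
  proof (rule mult_mono)
    show "1 - \<eta> \<le> exp (- R)" using exp_ge_add_one_self[of "- R"] R by linarith
    have "(1 - \<eta>) * e \<le> r * e" using r e by (intro mult_right_mono) auto
    thus "(1 - \<eta>) * e \<le> exp R * m" using m(3) by linarith
  qed (use \<eta> e in auto)
  also have "\<dots> = m" by (simp add: mult.assoc[symmetric] flip: exp_add)
  finally have "(1 - \<eta>) * ((1 - \<eta>) * e) \<le> m" .
  moreover have "(1 - \<eta>) * ((1 - \<eta>) * e) \<ge> e - 2 * \<eta> * e"
    using e \<eta> by (simp add: algebra_simps)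
  moreover have "2 * \<eta> * e \<le> 5 * \<eta> * e" using \<eta> e by simp
  ultimately have "e - m \<le> \<delta>" using e by linarith
  with upper show ?thesis by linarith
qed

section \<open>From the ratio in (A3) to the distribution function, for one sample\<close>

context bvm_model begin

lemma dev_measurable [measurable]: "dev n x \<in> borel_measurable \<pi>"
proof -
  have "(\<lambda>f. LINT y|leb01. f y * \<psi> y) \<in> borel_measurable \<pi>"
    by (rule measurable_prior_integral[OF prior, of "\<lambda>a y. a * \<psi> y"]) measurable
  thus ?thesis by (simp add: dev_def[abs_def] Psi_def[abs_def])
qed

text \<open>For a fixed sample the deviation is bounded over all densities, so its exponential
  moments exist for every t. The bound grows with n and serves integrability only.\<close>

lemma abs_dev_le:
  assumes "f \<in> space \<pi>"
  shows "\<bar>dev n x f\<bar> \<le> sqrt (real n) * (K + \<bar>Pn n x \<psi>\<bar>)"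
proof -
  have "f \<in> densities" using assms prior by (auto simp: prior_def)
  hence "\<bar>Psi \<psi> f\<bar> \<le> K"
    unfolding Psi_def by (rule abs_integral_density_mult_le[OF _ psi psi_le])
  thus ?thesis unfolding dev_def abs_mult by (intro mult_mono) auto
qed

lemma exp_dev_le:
  assumes "f \<in> space \<pi>"
  shows "exp (t * dev n x f) \<le> exp (\<bar>t\<bar> * (sqrt (real n) * (K + \<bar>Pn n x \<psi>\<bar>)))"
proof -
  have "t * dev n x f \<le> \<bar>t\<bar> * \<bar>dev n x f\<bar>" by (simp flip: abs_mult)
  also have "\<dots> \<le> \<bar>t\<bar> * (sqrt (real n) * (K + \<bar>Pn n x \<psi>\<bar>))"
    by (intro mult_left_mono abs_dev_le[OF assms]) auto
  finally show ?thesis by simp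
qed

lemma shifted_weight_measurable:
  assumes n: "n > 0" and x: "\<forall>i<n. x i \<in> {0..1}"
  shows "(\<lambda>f. lan_weight f\<^sub>0 n x (\<lambda>y. h_of f\<^sub>0 n f y - t * psi_bar f\<^sub>0 \<psi> t n (h_of f\<^sub>0 n f) y)) \<in> borel_measurable \<pi>"
    and "(\<lambda>f. lan_weight f\<^sub>0 n x (h_of f\<^sub>0 n f)) \<in> borel_measurable \<pi>"
proof -
  have eval: "(\<lambda>f. f (x i)) \<in> borel_measurable \<pi>" if "i < n" for i
    using measurable_prior_eval[OF prior, of "\<lambda>f. f" \<pi> "\<lambda>_. x i"] x that by (simp add: measurable_const)
  have h: "(\<lambda>f. h_of f\<^sub>0 n f (x i)) \<in> borel_measurable \<pi>" if "i < n" for i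
    unfolding h_of_def using eval[OF that] by simp
  have "(\<lambda>f. F0 f\<^sub>0 (\<lambda>y. exp (h_of f\<^sub>0 n f y / sqrt (real n) - t * psi_c f\<^sub>0 \<psi> y / sqrt (real n)))) \<in> borel_measurable \<pi>"
    unfolding F0_def h_of_def
    by (rule measurable_prior_integral[OF prior, of "\<lambda>a y. f\<^sub>0 y * exp (sqrt (real n) * ln (a / f\<^sub>0 y) / sqrt (real n)
        - t * psi_c f\<^sub>0 \<psi> y / sqrt (real n))"]) measurable
  hence "(\<lambda>f. psi_bar f\<^sub>0 \<psi> t n (h_of f\<^sub>0 n f) y) \<in> borel_measurable \<pi>" for y
    unfolding psi_bar_def by simp
  with h have "(\<lambda>f. \<Sum>i<n. h_of f\<^sub>0 n f (x i) - t * psi_bar f\<^sub>0 \<psi> t n (h_of f\<^sub>0 n f) (x i)) \<in> borel_measurable \<pi>"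
    by (intro borel_measurable_sum borel_measurable_diff borel_measurable_times) auto
  thus "(\<lambda>f. lan_weight f\<^sub>0 n x (\<lambda>y. h_of f\<^sub>0 n f y - t * psi_bar f\<^sub>0 \<psi> t n (h_of f\<^sub>0 n f) y)) \<in> borel_measurable \<pi>"
    unfolding lan_weight_eq[OF n]
    by measurable
  from h have "(\<lambda>f. \<Sum>i<n. h_of f\<^sub>0 n f (x i)) \<in> borel_measurable \<pi>"
    by (intro borel_measurable_sum) auto
  thus "(\<lambda>f. lan_weight f\<^sub>0 n x (h_of f\<^sub>0 n f)) \<in> borel_measurable \<pi>"
    unfolding lan_weight_eq[OF n]
    by measurable
qed

text \<open>The \<rho> of \<open>lan_weight_shift\<close> varies with f, but its bound does not, so
  integrating pointwise inequalities over A costs only the constant factors exp (\<plusminus>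
  remainder). The number m is the Laplace transform of \<open>dev\<close> at t under the posterior
  conditioned on A.\<close>

lemma shift_ratio_bounds:
  assumes n: "n > 0" and t: "t \<noteq> 0" and v: "0 < v" "\<bar>u\<bar> \<le> v" and nt: "\<bar>t\<bar> * (2 * K) \<le> sqrt (real n) / 6"
    and A [measurable]: "A \<in> sets \<pi>" and A1: "A \<subseteq> A1 f\<^sub>0 u"
    and x: "\<forall>i<n. x i \<in> {0..1}" and f0_x: "\<forall>i<n. 0 < f\<^sub>0 (x i)"
    and pos: "AE f in \<pi>. f \<in> A \<longrightarrow> (\<forall>i<n. 0 < f (x i))"
    and int: "integrable \<pi> (likelihood n x)"
  defines "c \<equiv> LINT f|\<pi>. indicator A f * likelihood n x f"
  defines "m \<equiv> (LINT f|\<pi>. indicator A f * likelihood n x f * exp (t * dev n x f)) / c"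
  assumes c: "0 < c"
  shows "exp (- remainder n t v) * m \<le> shift_ratio f\<^sub>0 \<psi> \<pi> A t n x * exp (t\<^sup>2 * \<sigma>2 / 2)"
    and "shift_ratio f\<^sub>0 \<psi> \<pi> A t n x * exp (t\<^sup>2 * \<sigma>2 / 2) \<le> exp (remainder n t v) * m"
proof -
  let ?L = "likelihood n x" and ?R = "remainder n t v"
  let ?W = "\<lambda>f. lan_weight f\<^sub>0 n x (\<lambda>y. h_of f\<^sub>0 n f y - t * psi_bar f\<^sub>0 \<psi> t n (h_of f\<^sub>0 n f) y)"
  note [measurable] = shifted_weight_measurable(1)[OF n x, where t = t] shifted_weight_measurable(2)[OF n x]
  have L [measurable]: "?L \<in> borel_measurable \<pi>" using int by simp
  have L_nonneg: "AE f in \<pi>. 0 \<le> ?L f" by (rule AE_I2) (rule likelihood_nonneg[OF prior _ x])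
  define L0 where "L0 = ?L f\<^sub>0"
  have L0: "L0 > 0" unfolding L0_def likelihood_def by (intro prod_pos) (use f0_x in auto)
  \<comment> \<open>All factors of the shifted weight that do not depend on f. The true likelihood
    in it cancels against the denominator of the ratio.\<close>
  define \<kappa> where "\<kappa> = exp (- (t\<^sup>2 * \<sigma>2 / 2)) / L0"
  have \<kappa>: "\<kappa> > 0" using L0 by (simp add: \<kappa>_def)
  define G where "G f = indicator A f * ?L f * exp (t * dev n x f)" for f
  have int_A: "integrable \<pi> (\<lambda>f. indicator A f * ?L f)"
    using integrable_real_mult_indicator[OF A int] by (simp add: mult.commute)
  have int_G: "integrable \<pi> G"
  proof (rule Bochner_Integration.integrable_bound)
    let ?C = "exp (\<bar>t\<bar> * (sqrt (real n) * (K + \<bar>Pn n x \<psi>\<bar>)))"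
    show "integrable \<pi> (\<lambda>f. indicator A f * ?L f * ?C)" using int_A by simp
    show "AE f in \<pi>. norm (G f) \<le> norm (indicator A f * ?L f * ?C)"
      by (rule AE_I2) (auto simp: G_def abs_mult intro!: mult_left_mono exp_dev_le)
  qed (simp add: G_def[abs_def])
  have bounds: "AE f in \<pi>. exp (- ?R) * \<kappa> * G f \<le> indicator A f * ?W f \<and>
      indicator A f * ?W f \<le> exp ?R * \<kappa> * G f"
    using pos L_nonneg
  proof eventually_elim
    case (elim f)
    show ?case
    proof (cases "f \<in> A")
      case True
      then obtain \<rho> where \<rho>: "\<bar>\<rho>\<bar> \<le> ?R"
        and W: "?W f = ?L f / ?L f\<^sub>0 * exp (t * dev n x f - t\<^sup>2 * \<sigma>2 / 2 + \<rho>)"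
        using lan_weight_shift[OF n t v nt, of f x] A1 f0_x elim by blast
      have "exp (t * dev n x f - t\<^sup>2 * \<sigma>2 / 2 + \<rho>) = exp (t * dev n x f) * exp (- (t\<^sup>2 * \<sigma>2 / 2)) * exp \<rho>"
        by (simp flip: exp_add)
      hence "indicator A f * ?W f = exp \<rho> * (\<kappa> * G f)"
        using True unfolding W by (simp add: G_def \<kappa>_def L0_def)
      moreover have "0 \<le> \<kappa> * G f" using \<kappa> elim(2) by (simp add: G_def)
      ultimately show ?thesis
        using mult_right_mono[of "exp (- ?R)" "exp \<rho>" "\<kappa> * G f"] mult_right_mono[of "exp \<rho>" "exp ?R" "\<kappa> * G f"] \<rho>
        by (simp add: mult.assoc abs_le_iff)
    qed (simp add: G_def)
  qed
  have G_nonneg: "AE f in \<pi>. 0 \<le> G f" using L_nonneg by eventually_elim (simp add: G_def)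
  \<comment> \<open>The pointwise upper bound provides integrability, without which the integral in
    the numerator would only be the default value 0.\<close>
  have int_W: "integrable \<pi> (\<lambda>f. indicator A f * ?W f)"
  proof (rule Bochner_Integration.integrable_bound)
    show "integrable \<pi> (\<lambda>f. exp ?R * \<kappa> * G f)" using int_G by simp
    show "AE f in \<pi>. norm (indicator A f * ?W f) \<le> norm (exp ?R * \<kappa> * G f)"
      using bounds G_nonneg
    proof eventually_elim
      case (elim f)
      have "0 \<le> indicator A f * ?W f" by (simp add: lan_weight_def)
      with elim show ?case by simp
    qed
  qed simp
  define N where "N = (LINT f|\<pi>. indicator A f * ?W f)"
  have G_int: "(LINT f|\<pi>. G f) = c * m" using c by (simp add: m_def G_def)
  have lower: "exp (- ?R) * \<kappa> * (c * m) \<le> N"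
    unfolding N_def G_int[symmetric] integral_mult_right_zero[symmetric]
    by (rule integral_mono_AE) (use int_G int_W bounds in auto)
  have upper: "N \<le> exp ?R * \<kappa> * (c * m)"
    unfolding N_def G_int[symmetric] integral_mult_right_zero[symmetric]
    by (rule integral_mono_AE) (use int_G int_W bounds in auto)
  have den: "(LINT f:A|\<pi>. lan_weight f\<^sub>0 n x (h_of f\<^sub>0 n f)) = c / L0"
  proof -
    have "(LINT f:A|\<pi>. lan_weight f\<^sub>0 n x (h_of f\<^sub>0 n f)) = (LINT f|\<pi>. indicator A f * ?L f / L0)"
      unfolding set_lebesgue_integral_def
    proof (rule integral_cong_AE)
      show "AE f in \<pi>. indicator A f *\<^sub>R lan_weight f\<^sub>0 n x (h_of f\<^sub>0 n f) = indicator A f * ?L f / L0"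
        using pos
      proof eventually_elim
        case (elim f)
        thus ?case
          using lan_weight_h_of[OF n, of f\<^sub>0 x f] f0_x by (cases "f \<in> A") (auto simp: L0_def)
      qed
    qed simp_all
    thus ?thesis by (simp add: c_def)
  qed
  have "shift_ratio f\<^sub>0 \<psi> \<pi> A t n x = N / (c / L0)"
    using t unfolding shift_ratio_def den by (simp add: N_def set_lebesgue_integral_def)
  hence ratio: "shift_ratio f\<^sub>0 \<psi> \<pi> A t n x * exp (t\<^sup>2 * \<sigma>2 / 2) = N / (\<kappa> * c)"
    using L0 c by (simp add: \<kappa>_def exp_minus field_simps)
  have \<kappa>c: "\<kappa> * c > 0" using \<kappa> c by simp
  show "exp (- ?R) * m \<le> shift_ratio f\<^sub>0 \<psi> \<pi> A t n x * exp (t\<^sup>2 * \<sigma>2 / 2)"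
    unfolding ratio pos_le_divide_eq[OF \<kappa>c] using lower by (simp add: mult_ac)
  show "shift_ratio f\<^sub>0 \<psi> \<pi> A t n x * exp (t\<^sup>2 * \<sigma>2 / 2) \<le> exp ?R * m"
    unfolding ratio pos_divide_le_eq[OF \<kappa>c] using upper by (simp add: mult_ac)
qed

text \<open>Two errors add up. Conditioning the posterior on A changes probabilities by at most the
  missing mass, hence by \<eta>. Under the conditioned posterior, the Laplace transform of
  \<open>dev\<close> / \<sigma> is within \<delta> of the standard normal one on T, which costs
  \<epsilon>.\<close>

lemma posterior_cdf_near_gaussian:
  assumes n: "n > 0" and v: "0 < v" "\<bar>u\<bar> \<le> v" and \<sigma>: "0 < \<sigma>" "\<sigma>\<^sup>2 = \<sigma>2"
    and A [measurable]: "A \<in> sets \<pi>" and A1: "A \<subseteq> A1 f\<^sub>0 u"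
    and x: "\<forall>i<n. x i \<in> {0..1}" and f0_x: "\<forall>i<n. 0 < f\<^sub>0 (x i)"
    and pos: "AE f in \<pi>. f \<in> A \<longrightarrow> (\<forall>i<n. 0 < f (x i))"
    and T: "0 \<notin> T"
    and near: "\<And>\<mu>. real_distribution \<mu> \<Longrightarrow> (\<And>t. integrable \<mu> (\<lambda>x. exp (t * x))) \<Longrightarrow>
       (\<And>t. t \<in> T \<Longrightarrow> \<bar>(LINT x|\<mu>. exp (t * x)) - exp (t\<^sup>2 / 2)\<bar> \<le> \<delta>) \<Longrightarrow>
       \<bar>cdf \<mu> (z / \<sigma>) - cdf std_normal_distribution (z / \<sigma>)\<bar> < \<epsilon>"
    and \<eta>: "0 < \<eta>" "\<eta> < 1" "\<And>t. t \<in> T \<Longrightarrow> 5 * \<eta> * exp (t\<^sup>2 / 2) \<le> \<delta>"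
    and large: "\<And>t. t \<in> T \<Longrightarrow> remainder n (t / \<sigma>) v \<le> \<eta>"
      "\<And>t. t \<in> T \<Longrightarrow> \<bar>t / \<sigma>\<bar> * (2 * K) \<le> sqrt (real n) / 6"
    and ratio: "\<And>t. t \<in> T \<Longrightarrow> \<bar>shift_ratio f\<^sub>0 \<psi> \<pi> A (t / \<sigma>) n x - 1\<bar> \<le> \<eta>"
    and post_A: "\<bar>measure (posterior \<pi> n x) A - 1\<bar> \<le> \<eta>"
  shows "\<bar>measure (posterior \<pi> n x) {f \<in> space \<pi>. dev n x f \<le> z} - cdf std_normal_distribution (z / \<sigma>)\<bar> \<le> \<epsilon> + \<eta>"
proof -
  let ?L = "likelihood n x"
  define post where "post = measure (posterior \<pi> n x)"
  have nz: "measure (posterior \<pi> n x) A \<noteq> 0" using post_A \<eta> by auto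
  note norm = posterior_normalized[OF prior x nz A]
  have [measurable]: "?L \<in> borel_measurable \<pi>" using norm(1) by simp
  have L_nonneg: "AE f in \<pi>. 0 \<le> ?L f" by (rule AE_I2) (rule likelihood_nonneg[OF prior _ x])
  define d where "d = (LINT f|\<pi>. ?L f)"
  define c where "c = (LINT f|\<pi>. indicator A f * ?L f)"
  have d: "d > 0" using norm(2) by (simp add: d_def)
  have post: "post B = (LINT f|\<pi>. indicator B f * ?L f) / d" if "B \<in> sets \<pi>" for B
    using norm(3)[OF that] by (simp add: post_def d_def)
  have int_ind: "integrable \<pi> (\<lambda>f. indicator B f * ?L f)" if "B \<in> sets \<pi>" for B
    using integrable_real_mult_indicator[OF that norm(1)] by (simp add: mult.commute)
  have p: "1 - \<eta> \<le> post A" using post_A by (simp add: post_def abs_le_iff)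
  have cd: "post A = c / d" using post[OF A] by (simp add: c_def)
  have "0 < c / d" using p \<eta> unfolding cd by linarith
  hence c: "c > 0" using d by (simp add: zero_less_divide_iff)
  \<comment> \<open>The density, with respect to the prior, of the posterior conditioned on A; the
    integrated likelihood has cancelled.\<close>
  define w where "w f = indicator A f * ?L f / c" for f
  have w [measurable]: "w \<in> borel_measurable \<pi>" unfolding w_def by measurable
  have w_nonneg: "AE f in \<pi>. 0 \<le> w f" using L_nonneg by eventually_elim (use c in \<open>simp add: w_def\<close>)
  have int_w: "integrable \<pi> w" unfolding w_def using int_ind[OF A] by simp
  define \<nu> where "\<nu> = density \<pi> (\<lambda>f. ennreal (w f))"
  have \<nu>_integral: "(LINT f|\<nu>. g f) = (LINT f|\<pi>. w f * g f)" if "g \<in> borel_measurable \<pi>" for g :: "_ \<Rightarrow> real"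
    unfolding \<nu>_def using that w_nonneg by (subst integral_density) auto
  have "emeasure \<nu> (space \<nu>) = (\<integral>\<^sup>+f. ennreal (w f) \<partial>\<pi>)"
    by (simp add: \<nu>_def emeasure_density cong: nn_integral_cong)
  also have "\<dots> = ennreal (LINT f|\<pi>. w f)" by (rule nn_integral_eq_integral[OF int_w w_nonneg])
  also have "(LINT f|\<pi>. w f) = 1" using c by (simp add: w_def c_def)
  finally interpret \<nu>: prob_space \<nu> by (intro prob_spaceI) simp
  have [measurable]: "dev n x \<in> borel_measurable \<nu>" by (simp add: \<nu>_def)
  define \<mu> where "\<mu> = distr \<nu> borel (\<lambda>f. dev n x f / \<sigma>)"
  interpret \<mu>: real_distribution \<mu>
    unfolding \<mu>_def by (rule \<nu>.real_distribution_distr) measurable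
  define B where "B = {f \<in> space \<pi>. dev n x f \<le> z}"
  have B [measurable]: "B \<in> sets \<pi>" unfolding B_def by measurable
  define q where "q = post (A \<inter> B)"
  have "cdf \<mu> (z / \<sigma>) = measure \<nu> B"
  proof -
    have "(\<lambda>f. dev n x f / \<sigma>) -` {..z / \<sigma>} \<inter> space \<nu> = B"
      using \<sigma> by (auto simp: B_def \<nu>_def divide_le_cancel)
    thus ?thesis unfolding cdf_def \<mu>_def by (subst measure_distr) auto
  qed
  also have "\<dots> = (LINT f|\<nu>. indicator B f)" by (simp add: \<nu>_def)
  also have "\<dots> = (LINT f|\<pi>. w f * indicator B f)" by (rule \<nu>_integral) measurable
  also have "\<dots> = (LINT f|\<pi>. indicator (A \<inter> B) f * ?L f / c)"
    by (intro Bochner_Integration.integral_cong refl) (auto simp: w_def split: split_indicator)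
  also have "\<dots> = q / post A"
    unfolding q_def using c d by (simp add: cd post)
  finally have cdf_\<mu>: "cdf \<mu> (z / \<sigma>) = q / post A" .
  \<comment> \<open>Both the posterior mass of B and its conditional mass q / post A lie between q
    and q + (1 - post A), so they differ by at most 1 - post A.\<close>
  have q: "0 \<le> q" "q \<le> post A" "q \<le> post B" "post B \<le> q + (1 - post A)"
  proof -
    have mono: "post C \<le> post D" if "C \<in> sets \<pi>" "D \<in> sets \<pi>" "C \<subseteq> D" for C D
      unfolding post[OF that(1)] post[OF that(2)] using d L_nonneg
      by (intro divide_right_mono integral_mono_AE int_ind that)
         (use that in \<open>auto elim!: eventually_mono split: split_indicator\<close>)
    show "0 \<le> q" by (simp add: q_def post_def)
    show "q \<le> post A" "q \<le> post B" unfolding q_def by (auto intro!: mono)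
    have "(LINT f|\<pi>. indicator A f * ?L f) + (LINT f|\<pi>. indicator B f * ?L f) \<le>
        (LINT f|\<pi>. indicator (A \<inter> B) f * ?L f) + (LINT f|\<pi>. ?L f)"
      unfolding Bochner_Integration.integral_add[OF int_ind[OF A] int_ind[OF B], symmetric]
        Bochner_Integration.integral_add[OF int_ind[OF sets.Int[OF A B]] norm(1), symmetric]
      by (rule integral_mono_AE)
         (use int_ind norm(1) L_nonneg in \<open>auto elim!: eventually_mono split: split_indicator\<close>)
    hence "(LINT f|\<pi>. indicator B f * ?L f) \<le> (LINT f|\<pi>. indicator (A \<inter> B) f * ?L f) + (d - c)"
      by (simp add: d_def c_def)
    hence "post B \<le> ((LINT f|\<pi>. indicator (A \<inter> B) f * ?L f) + (d - c)) / d"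
      using d by (simp add: post divide_right_mono)
    also have "\<dots> = q + (1 - post A)" using d by (simp add: q_def post cd add_divide_distrib diff_divide_distrib)
    finally show "post B \<le> q + (1 - post A)" .
  qed
  have "post A > 0" using p \<eta> by linarith
  have "post A \<le> 1"
  proof -
    have "c \<le> d" unfolding c_def d_def
      by (rule integral_mono_AE)
         (use int_ind norm(1) L_nonneg in \<open>auto elim!: eventually_mono split: split_indicator\<close>)
    thus ?thesis using d by (simp add: cd)
  qed
  hence "q / post A \<ge> q" using \<open>post A > 0\<close> q(1) mult_left_mono[of "post A" 1 q] by (simp add: field_simps)
  moreover have "q / post A - q \<le> 1 - post A"
  proof -
    have "q / post A - q = q / post A * (1 - post A)" using \<open>post A > 0\<close> by (simp add: field_simps)
    also have "\<dots> \<le> 1 * (1 - post A)"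
      using \<open>post A > 0\<close> \<open>post A \<le> 1\<close> q by (intro mult_right_mono) auto
    finally show ?thesis by simp
  qed
  ultimately have "\<bar>post B - cdf \<mu> (z / \<sigma>)\<bar> \<le> \<eta>"
    using q p unfolding cdf_\<mu> by linarith
  moreover have "\<bar>cdf \<mu> (z / \<sigma>) - cdf std_normal_distribution (z / \<sigma>)\<bar> < \<epsilon>"
  proof (rule near[OF \<mu>.real_distribution_axioms])
    fix t
    have "integrable \<nu> (\<lambda>f. exp (t / \<sigma> * dev n x f))"
    proof (rule \<nu>.integrable_const_bound)
      show "AE f in \<nu>. norm (exp (t / \<sigma> * dev n x f)) \<le>
          exp (\<bar>t / \<sigma>\<bar> * (sqrt (real n) * (K + \<bar>Pn n x \<psi>\<bar>)))"
        by (rule AE_I2, subst real_norm_def, subst abs_exp_cancel, rule exp_dev_le) (simp add: \<nu>_def)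
    qed measurable
    thus "integrable \<mu> (\<lambda>x. exp (t * x))"
      unfolding \<mu>_def by (subst integrable_distr_eq) auto
    assume t: "t \<in> T"
    have t0: "t / \<sigma> \<noteq> 0" using t T \<sigma> by auto
    have "(LINT x|\<mu>. exp (t * x)) = (LINT f|\<nu>. exp (t / \<sigma> * dev n x f))"
      unfolding \<mu>_def by (subst integral_distr) auto
    also have "\<dots> = (LINT f|\<pi>. w f * exp (t / \<sigma> * dev n x f))" by (rule \<nu>_integral) measurable
    also have "\<dots> = (LINT f|\<pi>. indicator A f * ?L f * exp (t / \<sigma> * dev n x f)) / c"
      by (simp add: w_def)
    finally have mgf: "(LINT x|\<mu>. exp (t * x)) = \<dots>" .
    \<comment> \<open>Rescaling \<open>dev\<close> to unit variance is what moves the argument of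
      the ratio from t to t / \<sigma>.\<close>
    have e: "exp ((t / \<sigma>)\<^sup>2 * \<sigma>2 / 2) = exp (t\<^sup>2 / 2)"
      using \<sigma>(1) by (simp add: \<sigma>(2)[symmetric] power_divide)
    note bounds = shift_ratio_bounds[OF n t0 v large(2)[OF t] A A1 x f0_x pos norm(1), folded c_def, OF c,
        unfolded e, folded mgf]
    show "\<bar>(LINT x|\<mu>. exp (t * x)) - exp (t\<^sup>2 / 2)\<bar> \<le> \<delta>"
      by (rule mgf_error_le[OF \<eta>(1) _ _ \<eta>(3)[OF t] large(1)[OF t] ratio[OF t]])
         (use \<eta> bounds in \<open>auto intro!: integral_nonneg_AE\<close>)
  qed
  ultimately show ?thesis by (simp add: post_def[symmetric] B_def[symmetric])
qed

end

section \<open>Convergence in probability\<close>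

text \<open>Outside a null set, Y can be far from c only on the union of the finitely many events
  where some W deviates from 1 by more than \<eta>. The family and the threshold may depend on
  \<epsilon>, so that each accuracy can call on its own finite set of arguments t.\<close>

lemma tends_in_prob_of_finitely_many:
  assumes M: "prob_space M" and Y: "\<And>n. Y n \<in> borel_measurable M"
    and dom: "\<And>\<epsilon>. 0 < \<epsilon> \<Longrightarrow> \<exists>S \<eta>. finite S \<and> 0 < \<eta> \<and> (\<forall>W\<in>S. tends_in_prob M W 1) \<and>
      (\<forall>\<^sub>F n in sequentially. AE \<omega> in M. (\<forall>W\<in>S. \<bar>W n \<omega> - 1\<bar> \<le> \<eta>) \<longrightarrow> \<bar>Y n \<omega> - c\<bar> \<le> \<epsilon>)"
  shows "tends_in_prob M Y c"
proof -
  interpret prob_space M by fact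
  have "(\<lambda>n. \<P>(\<omega> in M. \<epsilon> < \<bar>Y n \<omega> - c\<bar>)) \<longlonglongrightarrow> 0" if \<epsilon>: "0 < \<epsilon>" for \<epsilon>
  proof -
    obtain S \<eta> where S: "finite S" "0 < \<eta>" "\<And>W. W \<in> S \<Longrightarrow> tends_in_prob M W 1"
      and ev: "\<forall>\<^sub>F n in sequentially. AE \<omega> in M. (\<forall>W\<in>S. \<bar>W n \<omega> - 1\<bar> \<le> \<eta>) \<longrightarrow> \<bar>Y n \<omega> - c\<bar> \<le> \<epsilon>"
      using dom[OF \<epsilon>] by blast
    define B where "B W n = {\<omega> \<in> space M. \<eta> < \<bar>W n \<omega> - 1\<bar>}" for W :: "nat \<Rightarrow> _ \<Rightarrow> real" and n
    have B: "B W n \<in> events" if "W \<in> S" for W n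
    proof -
      have [measurable]: "W n \<in> borel_measurable M" using S(3)[OF that] by (simp add: tends_in_prob_def)
      show ?thesis unfolding B_def by measurable
    qed
    have lim: "(\<lambda>n. \<Sum>W\<in>S. prob (B W n)) \<longlonglongrightarrow> 0"
      using S by (intro tendsto_null_sum) (simp add: tends_in_prob_def B_def)
    show ?thesis
    proof (rule tendsto_sandwich[OF _ _ tendsto_const lim])
      show "\<forall>\<^sub>F n in sequentially. \<P>(\<omega> in M. \<epsilon> < \<bar>Y n \<omega> - c\<bar>) \<le> (\<Sum>W\<in>S. prob (B W n))"
        using ev
      proof eventually_elim
        case (elim n)
        have "\<P>(\<omega> in M. \<epsilon> < \<bar>Y n \<omega> - c\<bar>) \<le> prob (\<Union>W\<in>S. B W n)"
        proof (rule finite_measure_mono_AE)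
          show "AE \<omega> in M. \<omega> \<in> {\<omega> \<in> space M. \<epsilon> < \<bar>Y n \<omega> - c\<bar>} \<longrightarrow> \<omega> \<in> (\<Union>W\<in>S. B W n)"
            using elim by eventually_elim (auto simp: B_def not_le)
          show "(\<Union>W\<in>S. B W n) \<in> events" using S B by (intro sets.finite_UN) auto
        qed
        also have "\<dots> \<le> (\<Sum>W\<in>S. prob (B W n))"
          using S B by (intro finite_measure_subadditive_finite) auto
        finally show ?case .
      qed
    qed simp
  qed
  with Y show ?thesis by (simp add: tends_in_prob_def)
qed

lemma Phi_zero: "Phi 0 z = (if 0 \<le> z then 1 else 0)"
  by (simp add: Phi_def centered_gaussian_def cdf_def measure_return indicator_def)

lemma Phi_eq_std_normal:
  assumes \<sigma>: "0 < \<sigma>"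
  shows "Phi (\<sigma>\<^sup>2) z = cdf std_normal_distribution (z / \<sigma>)"
proof -
  define N where "N = density lborel (normal_density 0 \<sigma>)"
  interpret N: prob_space N unfolding N_def by (rule prob_space_normal_density[OF \<sigma>])
  have "distributed N lborel (\<lambda>x. x) (normal_density 0 \<sigma>)"
    by (simp add: distributed_def N_def distr_id2)
  hence "distributed N lborel (\<lambda>x. (x - 0) / \<sigma>) std_normal_density"
    by (subst N.normal_standard_normal_convert[symmetric, OF \<sigma>])
  hence std: "distr N lborel (\<lambda>x. x / \<sigma>) = std_normal_distribution"
    by (simp add: distributed_distr_eq_density)
  have "(\<lambda>x. x / \<sigma>) -` {..z / \<sigma>} \<inter> space N = {..z}"
    using \<sigma> by (auto simp: N_def divide_le_cancel)
  hence "cdf std_normal_distribution (z / \<sigma>) = measure N {..z}"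
    unfolding cdf_def std[symmetric] by (subst measure_distr) (auto simp: N_def)
  thus ?thesis using \<sigma> by (simp add: Phi_def centered_gaussian_def cdf_def N_def)
qed

lemma AE_distributed:
  assumes "distributed M N X g" and P: "AE x in N. P x"
  shows "AE \<omega> in M. P (X \<omega>)"
proof -
  have "AE x in distr M N X. P x"
    unfolding distributed_distr_eq_density[OF assms(1)] AE_density[OF distributed_borel_measurable[OF assms(1)]]
    using P by eventually_elim simp
  thus ?thesis by (rule AE_distrD[OF distributed_measurable[OF assms(1)]])
qed

section \<open>Exceptional samples, the degenerate case and the limit\<close>

context bvm_model begin

text \<open>Each f in A is positive at the observations almost surely, but the exceptional event
  depends on f and A may be uncountable. Fubini exchanges the quantifiers: almost surely, the
  failure is confined to a set of f that is null for the prior.\<close>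

lemma AE_sample_pos:
  fixes X :: "nat \<Rightarrow> 'w \<Rightarrow> real"
  assumes M: "prob_space M" and distr: "\<And>i. distributed M leb01 (X i) (\<lambda>x. ennreal (f\<^sub>0 x))"
    and A [measurable]: "A \<in> sets \<pi>" and A1: "A \<subseteq> A1 f\<^sub>0 u"
  shows "AE \<omega> in M. AE f in \<pi>. f \<in> A \<longrightarrow> (\<forall>i<n. 0 < f (X i \<omega>))"
proof -
  interpret M: prob_space M by fact
  interpret pair_sigma_finite M \<pi> ..
  have "AE \<omega> in M. AE f in \<pi>. f \<in> A \<longrightarrow> 0 < f (X i \<omega>)" for i
  proof (subst AE_commute)
    have X [measurable]: "X i \<in> measurable M leb01" by (rule distributed_measurable[OF distr])
    have [measurable]: "(\<lambda>w. (snd w) (X i (fst w))) \<in> borel_measurable (M \<Otimes>\<^sub>M \<pi>)"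
      by (rule measurable_prior_eval[OF prior]) measurable
    show "{w \<in> space (M \<Otimes>\<^sub>M \<pi>). snd w \<in> A \<longrightarrow> 0 < (snd w) (X i (fst w))} \<in> sets (M \<Otimes>\<^sub>M \<pi>)"
      by measurable
    have "AE \<omega> in M. 0 < f (X i \<omega>)" if "f \<in> A" for f
      using A1_AE_pos(1)[OF f0 f0_pos, of f u] A1 that by (intro AE_distributed[OF distr]) auto
    hence "AE \<omega> in M. f \<in> A \<longrightarrow> 0 < f (X i \<omega>)" for f by (cases "f \<in> A") simp_all
    thus "AE f in \<pi>. AE \<omega> in M. f \<in> A \<longrightarrow> 0 < f (X i \<omega>)" by simp
  qed
  hence "AE \<omega> in M. \<forall>i. AE f in \<pi>. f \<in> A \<longrightarrow> 0 < f (X i \<omega>)" by (simp add: AE_all_countable)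
  thus ?thesis
  proof eventually_elim
    case (elim \<omega>)
    hence "AE f in \<pi>. \<forall>i. f \<in> A \<longrightarrow> 0 < f (X i \<omega>)" by (subst AE_all_countable)
    thus ?case by eventually_elim auto
  qed
qed

text \<open>The sample enters both the posterior and the event. Writing the event as a factor under
  one integral over the prior reduces the claim to joint measurability in the sample point and
  f.\<close>

lemma posterior_prob_measurable:
  assumes X [measurable]: "\<And>i. X i \<in> measurable M leb01"
  shows "(\<lambda>\<omega>. measure (posterior \<pi> n (\<lambda>i. X i \<omega>)) {f \<in> space \<pi>. dev n (\<lambda>i. X i \<omega>) f \<le> z}) \<in> borel_measurable M"
proof -
  have [measurable]: "(\<lambda>w. likelihood n (\<lambda>i. X i (fst w)) (snd w)) \<in> borel_measurable (M \<Otimes>\<^sub>M \<pi>)"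
    by (rule measurable_likelihood[OF prior]) measurable
  have [measurable]: "(\<lambda>f. Psi \<psi> f) \<in> borel_measurable \<pi>"
    unfolding Psi_def by (rule measurable_prior_integral[OF prior, of "\<lambda>a y. a * \<psi> y"]) measurable
  have dev2 [measurable]: "(\<lambda>w. dev n (\<lambda>i. X i (fst w)) (snd w)) \<in> borel_measurable (M \<Otimes>\<^sub>M \<pi>)"
    unfolding dev_def Pn_def by measurable
  have D [measurable]: "(\<lambda>\<omega>. \<integral>\<^sup>+g. ennreal (likelihood n (\<lambda>i. X i \<omega>) g) \<partial>\<pi>) \<in> borel_measurable M"
    by (intro \<pi>.borel_measurable_nn_integral) (simp add: case_prod_beta')
  have "(\<lambda>\<omega>. \<integral>\<^sup>+f. ennreal (likelihood n (\<lambda>i. X i \<omega>) f) / (\<integral>\<^sup>+g. ennreal (likelihood n (\<lambda>i. X i \<omega>) g) \<partial>\<pi>)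
      * (if dev n (\<lambda>i. X i \<omega>) f \<le> z then 1 else 0) \<partial>\<pi>) \<in> borel_measurable M" (is "?I \<in> _")
    by (intro \<pi>.borel_measurable_nn_integral) (simp add: case_prod_beta')
  moreover have "emeasure (posterior \<pi> n (\<lambda>i. X i \<omega>)) {f \<in> space \<pi>. dev n (\<lambda>i. X i \<omega>) f \<le> z} = ?I \<omega>"
    if "\<omega> \<in> space M" for \<omega>
  proof -
    have [measurable]: "likelihood n (\<lambda>i. X i \<omega>) \<in> borel_measurable \<pi>"
      using measurable_likelihood[OF prior, of "\<lambda>f. f" \<pi> n "\<lambda>_ i. X i \<omega>"] measurable_space[OF X that]
      by (simp add: measurable_const)
    show ?thesis
      unfolding posterior_def
      by (subst emeasure_density) (auto intro!: nn_integral_cong split: split_indicator)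
  qed
  ultimately have "(\<lambda>\<omega>. enn2real (emeasure (posterior \<pi> n (\<lambda>i. X i \<omega>)) {f \<in> space \<pi>. dev n (\<lambda>i. X i \<omega>) f \<le> z})) \<in> borel_measurable M"
    by (subst measurable_cong[where g = "\<lambda>\<omega>. enn2real (?I \<omega>)"]) auto
  thus ?thesis by (simp add: measure_def)
qed

lemma \<sigma>2_nonneg: "0 \<le> \<sigma>2"
  unfolding \<sigma>2_def F0_def using f0_pos by (intro integral_nonneg_AE) (auto elim!: eventually_mono)

text \<open>Since \<open>f\<^sub>0\<close> is positive almost everywhere, zero variance makes \<psi>
  constant almost everywhere for Lebesgue measure, not merely on a part of the interval. Hence
  \<open>Psi\<close> takes this constant value at every density, and the sample average takes it
  almost surely.\<close>

lemma dev_degenerate: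
  fixes X :: "nat \<Rightarrow> 'w \<Rightarrow> real"
  assumes \<sigma>2: "\<sigma>2 = 0" and n: "n > 0"
    and M: "prob_space M" and distr: "\<And>i. distributed M leb01 (X i) (\<lambda>x. ennreal (f\<^sub>0 x))"
  shows "AE \<omega> in M. \<forall>f\<in>space \<pi>. dev n (\<lambda>i. X i \<omega>) f = 0"
proof -
  have psi_c2: "AE x in leb01. \<bar>(psi_c f\<^sub>0 \<psi> x)\<^sup>2\<bar> \<le> (2 * K)\<^sup>2"
    using psi_c_le
  proof eventually_elim
    case (elim x)
    show ?case using power_mono[OF elim, of 2] by simp
  qed
  have int: "integrable leb01 (\<lambda>x. f\<^sub>0 x * (psi_c f\<^sub>0 \<psi> x)\<^sup>2)"
    by (rule integrable_density_mult[OF f0 _ psi_c2]) measurable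
  have nonneg: "AE x in leb01. 0 \<le> f\<^sub>0 x * (psi_c f\<^sub>0 \<psi> x)\<^sup>2" using f0_pos by eventually_elim simp
  have "AE x in leb01. f\<^sub>0 x * (psi_c f\<^sub>0 \<psi> x)\<^sup>2 = 0"
    using \<sigma>2 integral_nonneg_eq_0_iff_AE[OF int nonneg] by (simp add: \<sigma>2_def F0_def)
  hence psi_0: "AE x in leb01. psi_c f\<^sub>0 \<psi> x = 0" using f0_pos by eventually_elim simp
  have Psi: "Psi \<psi> f = F0 f\<^sub>0 \<psi>" if f: "f \<in> space \<pi>" for f
  proof -
    have fd: "f \<in> densities" using f prior by (auto simp: prior_def)
    have [measurable]: "f \<in> borel_measurable leb01" by (rule densitiesD(4)[OF fd])
    have "(LINT x|leb01. f x * psi_c f\<^sub>0 \<psi> x) = (LINT x|leb01. 0)"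
      by (rule integral_cong_AE) (use psi_0 in \<open>auto elim!: eventually_mono\<close>)
    thus ?thesis using integral_psi_c[OF fd] by simp
  qed
  have "AE \<omega> in M. psi_c f\<^sub>0 \<psi> (X i \<omega>) = 0" for i by (rule AE_distributed[OF distr psi_0])
  hence "AE \<omega> in M. \<forall>i. psi_c f\<^sub>0 \<psi> (X i \<omega>) = 0" by (simp add: AE_all_countable)
  thus ?thesis
  proof eventually_elim
    case (elim \<omega>)
    hence "\<psi> (X i \<omega>) = F0 f\<^sub>0 \<psi>" for i by (simp add: psi_c_def)
    hence "Pn n (\<lambda>i. X i \<omega>) \<psi> = F0 f\<^sub>0 \<psi>" using n by (simp add: Pn_def)
    thus ?case by (simp add: dev_def Psi)
  qed
qed

theorem posterior_cdf_tends_in_prob: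
  fixes M :: "'w measure" and X :: "nat \<Rightarrow> 'w \<Rightarrow> real"
  assumes M: "prob_space M" and distr: "\<And>i. distributed M leb01 (X i) (\<lambda>x. ennreal (f\<^sub>0 x))"
    and u: "u \<longlonglongrightarrow> 0" and A: "\<And>n. A n \<in> sets \<pi>" and A1: "\<And>n. A n \<subseteq> A1 f\<^sub>0 (u n)"
    and post_A: "tends_in_prob M (\<lambda>n \<omega>. measure (posterior \<pi> n (\<lambda>i. X i \<omega>)) (A n)) 1"
    and ratio: "\<And>t. tends_in_prob M (\<lambda>n \<omega>. shift_ratio f\<^sub>0 \<psi> \<pi> (A n) t n (\<lambda>i. X i \<omega>)) 1"
  shows "tends_in_prob M (\<lambda>n \<omega>. measure (posterior \<pi> n (\<lambda>i. X i \<omega>))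
      {f \<in> space \<pi>. dev n (\<lambda>i. X i \<omega>) f \<le> z} - Phi \<sigma>2 z) 0"
proof (rule tends_in_prob_of_finitely_many[OF M])
  have X: "X i \<in> measurable M leb01" for i by (rule distributed_measurable[OF distr])
  have X01: "X i \<omega> \<in> {0..1}" if "\<omega> \<in> space M" for i \<omega> using measurable_space[OF X that] by simp
  show "(\<lambda>\<omega>. measure (posterior \<pi> n (\<lambda>i. X i \<omega>)) {f \<in> space \<pi>. dev n (\<lambda>i. X i \<omega>) f \<le> z} - Phi \<sigma>2 z)
      \<in> borel_measurable M" for n
    using posterior_prob_measurable[where X = X, OF X] by simp
  fix \<epsilon> :: real assume \<epsilon>: "0 < \<epsilon>"
  let ?post = "\<lambda>n \<omega>. measure (posterior \<pi> n (\<lambda>i. X i \<omega>)) (A n)"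
  let ?ratio = "\<lambda>t n \<omega>. shift_ratio f\<^sub>0 \<psi> \<pi> (A n) t n (\<lambda>i. X i \<omega>)"
  let ?Y = "\<lambda>n \<omega>. measure (posterior \<pi> n (\<lambda>i. X i \<omega>)) {f \<in> space \<pi>. dev n (\<lambda>i. X i \<omega>) f \<le> z} - Phi \<sigma>2 z"
  show "\<exists>S \<eta>. finite S \<and> 0 < \<eta> \<and> (\<forall>W\<in>S. tends_in_prob M W 1) \<and>
      (\<forall>\<^sub>F n in sequentially. AE \<omega> in M. (\<forall>W\<in>S. \<bar>W n \<omega> - 1\<bar> \<le> \<eta>) \<longrightarrow> \<bar>?Y n \<omega> - 0\<bar> \<le> \<epsilon>)"
  proof (cases "\<sigma>2 = 0")
    case True
    \<comment> \<open>The tolerance 1/2 only ensures nonzero posterior mass, so that the posterior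
      is a probability measure. Then the two distribution functions agree exactly.\<close>
    have "\<forall>\<^sub>F n in sequentially. AE \<omega> in M. \<bar>?post n \<omega> - 1\<bar> \<le> 1 / 2 \<longrightarrow> \<bar>?Y n \<omega> - 0\<bar> \<le> \<epsilon>"
      using eventually_gt_at_top[of 0]
    proof eventually_elim
      case (elim n)
      show ?case using dev_degenerate[where X = X, OF True elim M distr] AE_space
      proof eventually_elim
        case (elim \<omega>)
        show ?case
        proof
          assume post: "\<bar>?post n \<omega> - 1\<bar> \<le> 1 / 2"
          have x: "\<forall>i<n. X i \<omega> \<in> {0..1}" using X01 elim by blast
          have nz: "?post n \<omega> \<noteq> 0" using post by auto
          note norm = posterior_normalized[OF prior x nz A]
          have "(LINT f|\<pi>. indicator (space \<pi>) f * likelihood n (\<lambda>i. X i \<omega>) f)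
              = (LINT f|\<pi>. likelihood n (\<lambda>i. X i \<omega>) f)"
            by (intro Bochner_Integration.integral_cong) auto
          hence "measure (posterior \<pi> n (\<lambda>i. X i \<omega>)) (space \<pi>) = 1"
            using norm(2) norm(3)[of "space \<pi>"] by simp
          moreover have "{f \<in> space \<pi>. dev n (\<lambda>i. X i \<omega>) f \<le> z} = (if 0 \<le> z then space \<pi> else {})"
            using elim by auto
          ultimately show "\<bar>?Y n \<omega> - 0\<bar> \<le> \<epsilon>" using \<epsilon> by (simp add: True Phi_zero)
        qed
      qed
    qed
    thus ?thesis
      using post_A by (intro exI[of _ "{?post}"] exI[of _ "1 / 2 :: real"]) simp
  next
    case False
    define \<sigma> where "\<sigma> = sqrt \<sigma>2"
    have \<sigma>: "0 < \<sigma>" "\<sigma>\<^sup>2 = \<sigma>2" using False \<sigma>2_nonneg by (auto simp: \<sigma>_def)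
    have "0 < \<epsilon> / 2" using \<epsilon> by simp
    then obtain T \<delta> where T: "finite T" "0 \<notin> T" and \<delta>: "\<delta> > 0"
      and near: "\<And>\<mu>. real_distribution \<mu> \<Longrightarrow> (\<And>t. integrable \<mu> (\<lambda>x. exp (t * x))) \<Longrightarrow>
       (\<And>t. t \<in> T \<Longrightarrow> \<bar>(LINT x|\<mu>. exp (t * x)) - exp (t\<^sup>2 / 2)\<bar> \<le> \<delta>) \<Longrightarrow>
       \<bar>cdf \<mu> (z / \<sigma>) - cdf std_normal_distribution (z / \<sigma>)\<bar> < \<epsilon> / 2"
      using cdf_near_std_normal_of_mgf by metis
    \<comment> \<open>A common bound for the Gaussian values over T, so that one \<eta> serves all
      of them. The summand 1 keeps it positive if T is empty.\<close>
    define E where "E = 1 + (\<Sum>t\<in>T. exp (t\<^sup>2 / 2))"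
    have E: "exp (t\<^sup>2 / 2) \<le> E" if "t \<in> T" for t
      using member_le_sum[OF that, of "\<lambda>t. exp (t\<^sup>2 / 2)"] T(1) by (simp add: E_def)
    have "E > 0" unfolding E_def by (intro add_pos_nonneg sum_nonneg) auto
    define \<eta> where "\<eta> = min (1 / 2) (min (\<epsilon> / 2) (\<delta> / (5 * E)))"
    have \<eta>: "0 < \<eta>" "\<eta> < 1" "\<eta> \<le> \<epsilon> / 2" "\<eta> \<le> \<delta> / (5 * E)" using \<epsilon> \<delta> \<open>E > 0\<close> by (auto simp: \<eta>_def)
    have \<eta>E: "5 * \<eta> * exp (t\<^sup>2 / 2) \<le> \<delta>" if "t \<in> T" for t
    proof -
      have "5 * \<eta> * exp (t\<^sup>2 / 2) \<le> 5 * \<eta> * E" using E[OF that] \<eta> by (intro mult_left_mono) auto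
      also have "\<dots> \<le> \<delta>" using \<eta>(4) \<open>E > 0\<close> by (simp add: field_simps)
      finally show ?thesis .
    qed
    \<comment> \<open>A strictly positive majorant of |u n| that still tends to 0, since the L1
      bound divides by it.\<close>
    define v where "v n = \<bar>u n\<bar> + 1 / real (Suc n)" for n
    have v: "0 < v n" "\<bar>u n\<bar> \<le> v n" for n by (auto simp: v_def intro!: add_nonneg_pos)
    have "v \<longlonglongrightarrow> \<bar>0\<bar> + 0"
      unfolding v_def by (intro tendsto_add tendsto_rabs u LIMSEQ_Suc[OF lim_1_over_n])
    hence lim_v: "v \<longlonglongrightarrow> 0" by simp
    have large1: "\<forall>\<^sub>F n in sequentially. \<forall>t\<in>T. remainder n (t / \<sigma>) (v n) \<le> \<eta>"
    proof (intro eventually_ball_finite T ballI)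
      fix t
      from order_tendstoD(2)[OF remainder_tendsto[OF lim_v, of "t / \<sigma>"] \<eta>(1)]
      show "\<forall>\<^sub>F n in sequentially. remainder n (t / \<sigma>) (v n) \<le> \<eta>" by eventually_elim simp
    qed
    have "filterlim (\<lambda>n. sqrt (real n)) at_top sequentially"
      by (intro filterlim_compose[OF sqrt_at_top] filterlim_real_sequentially)
    hence "\<forall>\<^sub>F n in sequentially. 6 * (\<bar>t / \<sigma>\<bar> * (2 * K)) \<le> sqrt (real n)" for t
      by (simp add: filterlim_at_top)
    hence large2: "\<forall>\<^sub>F n in sequentially. \<forall>t\<in>T. 6 * (\<bar>t / \<sigma>\<bar> * (2 * K)) \<le> sqrt (real n)"
      by (intro eventually_ball_finite T) auto
    define S where "S = insert ?post ((\<lambda>t. ?ratio (t / \<sigma>)) ` T)"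
    have "\<forall>\<^sub>F n in sequentially. AE \<omega> in M. (\<forall>W\<in>S. \<bar>W n \<omega> - 1\<bar> \<le> \<eta>) \<longrightarrow> \<bar>?Y n \<omega> - 0\<bar> \<le> \<epsilon>"
      using eventually_gt_at_top[of 0] large1 large2
    proof eventually_elim
      case (elim n)
      have "AE \<omega> in M. 0 < f\<^sub>0 (X i \<omega>)" for i by (rule AE_distributed[OF distr f0_pos])
      hence "AE \<omega> in M. \<forall>i. 0 < f\<^sub>0 (X i \<omega>)" by (simp add: AE_all_countable)
      thus ?case
        using AE_sample_pos[where X = X and n = n, OF M distr A[of n] A1[of n]] AE_space
      proof eventually_elim
        case (elim \<omega>)
        show ?case
        proof
          assume W: "\<forall>W\<in>S. \<bar>W n \<omega> - 1\<bar> \<le> \<eta>"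
          have "\<bar>measure (posterior \<pi> n (\<lambda>i. X i \<omega>)) {f \<in> space \<pi>. dev n (\<lambda>i. X i \<omega>) f \<le> z}
              - cdf std_normal_distribution (z / \<sigma>)\<bar> \<le> \<epsilon> / 2 + \<eta>"
          proof (rule posterior_cdf_near_gaussian[OF _ v \<sigma> A A1 _ _ _ T(2) near \<eta>(1,2) \<eta>E])
            show "0 < n" by fact
            show "\<forall>i<n. X i \<omega> \<in> {0..1}" using X01 elim by blast
            show "\<forall>i<n. 0 < f\<^sub>0 (X i \<omega>)" using elim by blast
            show "AE f in \<pi>. f \<in> A n \<longrightarrow> (\<forall>i<n. 0 < f (X i \<omega>))" using elim by blast
            show "remainder n (t / \<sigma>) (v n) \<le> \<eta>" if "t \<in> T" for t
              using \<open>\<forall>t\<in>T. remainder n (t / \<sigma>) (v n) \<le> \<eta>\<close> that by blast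
            show "\<bar>t / \<sigma>\<bar> * (2 * K) \<le> sqrt (real n) / 6" if "t \<in> T" for t
              using \<open>\<forall>t\<in>T. 6 * (\<bar>t / \<sigma>\<bar> * (2 * K)) \<le> sqrt (real n)\<close> that by (simp add: mult.commute)
            show "\<bar>?ratio (t / \<sigma>) n \<omega> - 1\<bar> \<le> \<eta>" if "t \<in> T" for t
            proof -
              have "?ratio (t / \<sigma>) \<in> S" unfolding S_def using that by (intro insertI2 imageI)
              from bspec[OF W this] show ?thesis .
            qed
            show "\<bar>?post n \<omega> - 1\<bar> \<le> \<eta>"
            proof -
              have "?post \<in> S" unfolding S_def by (rule insertI1)
              from bspec[OF W this] show ?thesis .
            qed
          qed
          moreover have "Phi \<sigma>2 z = cdf std_normal_distribution (z / \<sigma>)"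
            using Phi_eq_std_normal[OF \<sigma>(1)] by (simp add: \<sigma>(2))
          ultimately show "\<bar>?Y n \<omega> - 0\<bar> \<le> \<epsilon>" using \<eta>(3) by simp
        qed
      qed
    qed
    moreover have "finite S" "\<forall>W\<in>S. tends_in_prob M W 1"
      using T post_A ratio by (auto simp: S_def)
    ultimately show ?thesis using \<eta>(1) by blast
  qed
qed

end

theorem theorem2p1:
  fixes f\<^sub>0 \<psi> :: "real \<Rightarrow> real"
    and \<pi> :: "(real \<Rightarrow> real) measure"
    and M :: "'w measure" and X :: "nat \<Rightarrow> 'w \<Rightarrow> real"
    and u :: "nat \<Rightarrow> real" and A :: "nat \<Rightarrow> (real \<Rightarrow> real) set"
  assumes f0: "f\<^sub>0 \<in> densities"
    and log_f0: "ess_norm (\<lambda>x. ext_ln (f\<^sub>0 x)) < \<infinity>"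
    and psi: "\<psi> \<in> borel_measurable leb01"
    and psi_bdd: "ess_norm (\<lambda>x. ereal (\<psi> x)) < \<infinity>"
    and M: "prob_space M"
    and indep: "prob_space.indep_vars M (\<lambda>_. leb01) X UNIV"
    and distr: "\<And>i. distributed M leb01 (X i) (\<lambda>x. ennreal (f\<^sub>0 x))"
    and prior: "prior \<pi>"
    and A1_u: "u \<longlonglongrightarrow> 0"
    and A1_post: "tends_in_prob M
      (\<lambda>n \<omega>. \<P>(f in posterior \<pi> n (\<lambda>i. X i \<omega>). f \<in> A1 f\<^sub>0 (u n))) 1"
    and A2_meas: "\<And>n. A n \<in> sets \<pi>"
    and A2_sub: "\<And>n. A n \<subseteq> A1 f\<^sub>0 (u n)"
    and A2_unif: "(\<lambda>n. SUP f\<in>A n. third_moment f\<^sub>0 f) \<longlonglongrightarrow> 0"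
    and A2_post: "tends_in_prob M
      (\<lambda>n \<omega>. \<P>(f in posterior \<pi> n (\<lambda>i. X i \<omega>). f \<in> A n)) 1"
    and A3: "\<And>t. tends_in_prob M
      (\<lambda>n \<omega>. shift_ratio f\<^sub>0 \<psi> \<pi> (A n) t n (\<lambda>i. X i \<omega>)) 1"
  shows "\<forall>z. tends_in_prob M
      (\<lambda>n \<omega>. \<P>(f in posterior \<pi> n (\<lambda>i. X i \<omega>).
                   sqrt (real n) * (Psi \<psi> f - Pn n (\<lambda>i. X i \<omega>) \<psi>) \<le> z)
             - Phi (F0 f\<^sub>0 (\<lambda>x. (psi_c f\<^sub>0 \<psi> x)\<^sup>2)) z) 0"
proof -
  obtain K where K: "0 \<le> K" "AE x in leb01. \<bar>\<psi> x\<bar> \<le> K"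
    using ess_norm_finiteE[OF psi_bdd] by auto
  interpret bvm_model f\<^sub>0 \<psi> \<pi> K
    by unfold_locales (fact f0 AE_pos_of_log_bounded[OF log_f0] psi K prior)+
  have space: "space (posterior \<pi> n x) = space \<pi>" for n x by (simp add: posterior_def)
  have "{f \<in> space \<pi>. f \<in> A n} = A n" for n using sets.sets_into_space[OF A2_meas] by auto
  hence "tends_in_prob M (\<lambda>n \<omega>. measure (posterior \<pi> n (\<lambda>i. X i \<omega>)) (A n)) 1"
    using A2_post by (simp add: space)
  from posterior_cdf_tends_in_prob[OF M distr A1_u A2_meas A2_sub this A3]
  show ?thesis by (simp add: space dev_def \<sigma>2_def)
qed

end
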